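(* Fix $1\le r\le\infty$. Let $R$ be a partially ordered commutative ring and let $\boldsymbol{\phi}=(\phi_m)_{m\ge0}$ be a sequence in $R$ that is Toeplitz-totally positive of order $r$. Then: (a) The lower-triangular matrix $\mathsf{T}(y,\boldsymbol{\phi})=(t_{n,k}(y,\boldsymbol{\phi}))_{n,k\ge0}$ with entries in $R[y]$ is totally positive of order $r$ in $R[y]$ equipped with the coefficientwise order. (b) The sequence $\big(T_n(x,y,\boldsymbol{\phi})\big)_{n\ge0}$, $T_n(x,y,\boldsymbol{\phi})=\sum_{k=0}^n t_{n,k}(y,\boldsymbol{\phi})x^k$, is Hankel-totally positive of order $r$ in $R[x,y]$ equipped with the coefficientwise order.
   Context: A partially ordered commutative ring is a commutative ring $R$ (with $1\neq0$) together with a subset $\mathcal{P}$ ("nonnegative elements") with $0,1\in\mathcal{P}$, $\mathcal{P}+\mathcal{P}\subseteq\mathcal{P}$, $\mathcal{P}\mathcal{P}\subseteq\mathcal{P}$, $\mathcal{P}\cap(-\mathcal{P})=\{0\}$. On $R[\mathbf{x}]$ the coefficientwise order takes as nonnegative elements the polynomials all of whose coefficients lie in $\mathcal{P}$. A matrix is totally positive of order $r$ (TP$_r$) if all its minors of size $\le r$ are nonnegative. A sequence $(a_n)_{n\ge0}$ is Toeplitz-TP of order $r$ if the Toeplitz matrix $(a_{i-j})_{i,j\ge0}$ (with $a_n=0$ for $n<0$) is TP$_r$, and Hankel-TP of order $r$ if $(a_{i+j})_{i,j\ge0}$ is TP$_r$. Trees: for a rooted tree $T$ on a totally ordered vertex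 set, $j$ is a descendant of $i$ if the path from the root to $j$ passes through $i$ (including $j=i$); an edge $ij$ with $j$ a child of $i$ is improper if some descendant of $j$ is lower-numbered than $i$, proper otherwise; $\mathrm{imprope}(T)$ is the number of improper edges and $\mathrm{pdeg}_T(i)$ the number of children $j$ of $i$ with $ij$ proper. $\mathcal{T}^{\langle 1;k\rangle}_{n+1}$ is the set of rooted trees on $[n+1]$ in which vertex $1$ has exactly $k$ children. With $\widehat{\phi}_m=m!\,\phi_m$, $t_{n,k}(y,\boldsymbol{\phi})=\sum_{T\in\mathcal{T}^{\langle 1;k\rangle}_{n+1}} y^{\mathrm{imprope}(T)}\prod_{i=2}^{n+1}\widehat{\phi}_{\mathrm{pdeg}_T(i)}\in R[y]$ (zero for $k>n$). *)

theory Defs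
  imports
    "HOL-Library.Extended_Nat"
    "HOL-Computational_Algebra.Polynomial"
    "Jordan_Normal_Form.Determinant"
begin

definition partially_ordered_ring :: "'a::comm_ring_1 set \<Rightarrow> bool" where
  "partially_ordered_ring P \<longleftrightarrow>
     0 \<in> P \<and> 1 \<in> P \<and>
     (\<forall>a\<in>P. \<forall>b\<in>P. a + b \<in> P) \<and>
     (\<forall>a\<in>P. \<forall>b\<in>P. a * b \<in> P) \<and>
     P \<inter> uminus ` P = {0}"

definition coeffwise :: "'a::comm_ring_1 set \<Rightarrow> 'a poly set" where
  "coeffwise P = {p. \<forall>i. coeff p i \<in> P}"

lemma partially_ordered_ring_coeffwise:
  assumes "partially_ordered_ring P"
  shows "partially_ordered_ring (coeffwise P)"
proof -
  have P: "0 \<in> P" "1 \<in> P" "\<And>a b. a \<in> P \<Longrightarrow> b \<in> P \<Longrightarrow> a + b \<in> P"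
    "\<And>a b. a \<in> P \<Longrightarrow> b \<in> P \<Longrightarrow> a * b \<in> P" "P \<inter> uminus ` P = {0}"
    using assms by (auto simp: partially_ordered_ring_def)
  have sum_P: "sum f A \<in> P" if "\<And>x. x \<in> A \<Longrightarrow> f x \<in> P" for f :: "nat \<Rightarrow> _" and A
    using that by (induction A rule: infinite_finite_induct) (auto intro: P)
  have "p = 0" if "p \<in> coeffwise P" "q \<in> coeffwise P" "p = - q" for p q
  proof (rule poly_eqI)
    fix i
    have "coeff p i \<in> P \<inter> uminus ` P"
      using that by (auto simp: coeffwise_def)
    then show "coeff p i = coeff 0 i"
      using P(5) by simp
  qed
  moreover have "0 \<in> coeffwise P"
    using P(1) by (simp add: coeffwise_def)
  ultimately have "coeffwise P \<inter> uminus ` coeffwise P = {0}"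
    by (auto intro!: image_eqI[of 0 uminus 0])
  then show ?thesis
    unfolding partially_ordered_ring_def
    by (auto simp: coeffwise_def coeff_mult coeff_1 intro!: P sum_P)
qed

text \<open>
  Minors of an infinite matrix: rows \<open>I 0 < \<dots> < I (m - 1)\<close> and columns
  \<open>J 0 < \<dots> < J (m - 1)\<close>.
\<close>

definition minor :: "(nat \<Rightarrow> nat \<Rightarrow> 'a::comm_ring_1) \<Rightarrow> nat \<Rightarrow> (nat \<Rightarrow> nat) \<Rightarrow> (nat \<Rightarrow> nat) \<Rightarrow> 'a" where
  "minor M m I J = det (mat m m (\<lambda>(a, b). M (I a) (J b)))"

definition totally_positive ::
    "'a::comm_ring_1 set \<Rightarrow> enat \<Rightarrow> (nat \<Rightarrow> nat \<Rightarrow> 'a) \<Rightarrow> bool" where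
  "totally_positive P r M \<longleftrightarrow>
     (\<forall>m I J. enat m \<le> r \<longrightarrow> strict_mono_on {..<m} I \<longrightarrow> strict_mono_on {..<m} J \<longrightarrow>
        minor M m I J \<in> P)"

definition toeplitz_matrix :: "(nat \<Rightarrow> 'a::comm_ring_1) \<Rightarrow> nat \<Rightarrow> nat \<Rightarrow> 'a" where
  "toeplitz_matrix a i j = (if j \<le> i then a (i - j) else 0)"

definition hankel_matrix :: "(nat \<Rightarrow> 'a::comm_ring_1) \<Rightarrow> nat \<Rightarrow> nat \<Rightarrow> 'a" where
  "hankel_matrix a i j = a (i + j)"

definition toeplitz_totally_positive ::
    "'a::comm_ring_1 set \<Rightarrow> enat \<Rightarrow> (nat \<Rightarrow> 'a) \<Rightarrow> bool" where
  "toeplitz_totally_positive P r a \<longleftrightarrow> totally_positive P r (toeplitz_matrix a)"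

definition hankel_totally_positive ::
    "'a::comm_ring_1 set \<Rightarrow> enat \<Rightarrow> (nat \<Rightarrow> 'a) \<Rightarrow> bool" where
  "hankel_totally_positive P r a \<longleftrightarrow> totally_positive P r (hankel_matrix a)"

text \<open>
  A simple undirected graph is given by its set of edges, each a two-element set of
  vertices; paths and cycles are lists of distinct vertices.
\<close>

datatype 'v rooted_graph = Rooted_Graph (rg_root: 'v) (rg_edges: "'v set set")

definition is_path :: "'v set set \<Rightarrow> 'v \<Rightarrow> 'v \<Rightarrow> 'v list \<Rightarrow> bool" where
  "is_path E u v p \<longleftrightarrow>
     p \<noteq> [] \<and> hd p = u \<and> last p = v \<and> distinct p \<and> successively (\<lambda>a b. {a, b} \<in> E) p"

definition is_cycle :: "'v set set \<Rightarrow> 'v list \<Rightarrow> bool" where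
  "is_cycle E c \<longleftrightarrow>
     3 \<le> length c \<and> distinct c \<and> successively (\<lambda>a b. {a, b} \<in> E) c \<and> {last c, hd c} \<in> E"

definition rooted_tree_on :: "'v set \<Rightarrow> 'v rooted_graph \<Rightarrow> bool" where
  "rooted_tree_on V T \<longleftrightarrow>
     rg_root T \<in> V \<and>
     rg_edges T \<subseteq> {{u, v} | u v. u \<in> V \<and> v \<in> V \<and> u \<noteq> v} \<and>
     (\<forall>u\<in>V. \<forall>v\<in>V. \<exists>p. is_path (rg_edges T) u v p) \<and>
     (\<nexists>c. is_cycle (rg_edges T) c)"

text \<open>In the following predicates, the first vertex is the ancestor or parent.\<close>

definition descendant :: "'v rooted_graph \<Rightarrow> 'v \<Rightarrow> 'v \<Rightarrow> bool" where
  "descendant T i j \<longleftrightarrow> (\<exists>p. is_path (rg_edges T) (rg_root T) j p \<and> i \<in> set p)"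

definition child :: "'v rooted_graph \<Rightarrow> 'v \<Rightarrow> 'v \<Rightarrow> bool" where
  "child T i j \<longleftrightarrow> {i, j} \<in> rg_edges T \<and> descendant T i j"

definition improper_edge :: "'v::linorder rooted_graph \<Rightarrow> 'v \<Rightarrow> 'v \<Rightarrow> bool" where
  "improper_edge T i j \<longleftrightarrow> child T i j \<and> (\<exists>l. descendant T j l \<and> l < i)"

definition proper_edge :: "'v::linorder rooted_graph \<Rightarrow> 'v \<Rightarrow> 'v \<Rightarrow> bool" where
  "proper_edge T i j \<longleftrightarrow> child T i j \<and> \<not> improper_edge T i j"

definition imprope :: "'v::linorder rooted_graph \<Rightarrow> nat" where
  "imprope T = card {(i, j). improper_edge T i j}"

definition pdeg :: "'v::linorder rooted_graph \<Rightarrow> 'v \<Rightarrow> nat" where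
  "pdeg T i = card {j. proper_edge T i j}"

text \<open>Rooted trees on \<open>[n + 1]\<close> in which vertex 1 (not necessarily the root) has \<open>k\<close> children.\<close>

definition trees_1 :: "nat \<Rightarrow> nat \<Rightarrow> nat rooted_graph set" where
  "trees_1 n k = {T. rooted_tree_on {1..n + 1} T \<and> card {j. child T 1 j} = k}"

lemma finite_trees_1: "finite (trees_1 n k)"
proof (rule finite_subset)
  show "trees_1 n k \<subseteq>
      case_prod Rooted_Graph ` ({1..n + 1} \<times> Pow (Pow {1..n + 1}))"
  proof
    fix T assume "T \<in> trees_1 n k"
    then have "(rg_root T, rg_edges T) \<in> {1..n + 1} \<times> Pow (Pow {1..n + 1})"
      by (fastforce simp: trees_1_def rooted_tree_on_def)
    then show "T \<in> case_prod Rooted_Graph ` ({1..n + 1} \<times> Pow (Pow {1..n + 1}))"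
      by (rule rev_image_eqI) simp
  qed
qed simp

definition phi_hat :: "(nat \<Rightarrow> 'a::comm_ring_1) \<Rightarrow> nat \<Rightarrow> 'a" where
  "phi_hat \<phi> m = of_nat (fact m) * \<phi> m"

definition t_poly :: "(nat \<Rightarrow> 'a::comm_ring_1) \<Rightarrow> nat \<Rightarrow> nat \<Rightarrow> 'a poly" where
  "t_poly \<phi> n k = (\<Sum>T\<in>trees_1 n k. monom (\<Prod>i=2..n + 1. phi_hat \<phi> (pdeg T i)) (imprope T))"

lemma t_poly_eq_0:
  assumes "n < k"
  shows "t_poly \<phi> n k = 0"
proof -
  have "card {j. child T 1 j} \<le> n" if "rooted_tree_on {1..n + 1} T" for T
  proof -
    have "{j. child T 1 j} \<subseteq> {2..n + 1}"
    proof
      fix j assume "j \<in> {j. child T 1 j}"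
      then have "{1, j} \<in> rg_edges T"
        by (simp add: child_def)
      moreover have "rg_edges T \<subseteq> {{u, v} | u v. u \<in> {1..n + 1} \<and> v \<in> {1..n + 1} \<and> u \<noteq> v}"
        using that by (simp only: rooted_tree_on_def)
      ultimately have "{1, j} \<in> {{u, v} | u v. u \<in> {1..n + 1} \<and> v \<in> {1..n + 1} \<and> u \<noteq> v}"
        by (rule rev_subsetD)
      then obtain u v where "{1, j} = {u, v}" "u \<in> {1..n + 1}" "v \<in> {1..n + 1}" "u \<noteq> v"
        by (elim CollectE exE conjE)
      then have "j \<in> {1..n + 1}" "j \<noteq> 1"
        unfolding doubleton_eq_iff by blast+
      then show "j \<in> {2..n + 1}"
        by auto
    qed
    then have "card {j. child T 1 j} \<le> card {2..n + 1}"
      by (intro card_mono) auto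
    then show ?thesis by simp
  qed
  with assms have "trees_1 n k = {}"
    unfolding trees_1_def by (metis (mono_tags, lifting) Collect_empty_eq not_less)
  then show ?thesis
    by (simp add: t_poly_def)
qed

text \<open>\<open>R[x, y]\<close> is represented as \<open>R[y][x]\<close>: the outer indeterminate is \<open>x\<close>.\<close>

definition T_poly :: "(nat \<Rightarrow> 'a::comm_ring_1) \<Rightarrow> nat \<Rightarrow> 'a poly poly" where
  "T_poly \<phi> n = (\<Sum>k\<le>n. monom (t_poly \<phi> n k) k)"

end

theory Submission
  imports Defs
begin

text \<open>
  A tree is determined by its parent function. Let \<open>a < b\<close> be its two smallest vertices. If \<open>a\<close> is the
  parent of \<open>b\<close>, contract that edge, remembering which children of the merged vertex came from \<open>a\<close>.
  Otherwise one of two local surgeries turns the tree into one in which \<open>a\<close> has one more child, that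
  child being marked, and which has exactly one improper edge less. As \<open>a\<close> and \<open>b\<close> are minimal, no
  other edge changes its status, so that
  \<open>t (n+1) k = (\<Sum>j. (j choose (k-1)) * (j-k+1)! * \<phi> (j-k+1) * t n j) + (k+1) * y * t (n+1) (k+1)\<close>.

  Solving for \<open>t (n+1) k\<close> shows that \<open>t\<close> is the output matrix of the production matrix
  \<open>M\<^sub>\<phi> \<Delta> M\<^sub>y\<close>, where \<open>M\<^sub>\<phi>\<close> and \<open>M\<^sub>y\<close> have the entries \<open>n!/k! * \<phi> (n-k)\<close> and \<open>n!/k! * y^(n-k)\<close>, and
  \<open>\<Delta>\<close> has ones on the superdiagonal. The binomial matrix \<open>B\<^sub>x\<close> commutes with \<open>M\<^sub>\<phi>\<close> and \<open>M\<^sub>y\<close> and satisfies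
  \<open>\<Delta> B\<^sub>x = B\<^sub>x (\<Delta> + x I)\<close>. Hence \<open>t B\<^sub>x\<close>, whose zeroth column consists of the row polynomials, is the
  output matrix of \<open>M\<^sub>\<phi> (\<Delta> + x I) M\<^sub>y\<close>. All three factors are totally positive, hence so is the output
  matrix, and its zeroth column is Hankel-totally positive.
\<close>

text \<open>The weight omits the degree of the smallest vertex \<open>a\<close>, and edges below
  \<open>a\<close> are never improper. Children of \<open>a\<close> can therefore be moved freely,
  provided that the new edge below another vertex is improper and so invisible to that vertex's
  proper degree. The factor \<open>k+1\<close> in the recurrence counts the possible marked
  children. In a contracted tree the merged vertex has \<open>j\<close> children, \<open>k-1\<close>
  of which came from \<open>a\<close>; the other \<open>j-k+1\<close> came from \<open>b\<close>,
  and all of those edges were proper. This explains \<open>phi_hat\<close>: choosing the subset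
  contributes a binomial coefficient, and its product with \<open>(j-k+1)!\<close> is
  \<open>j!/(k-1)!\<close>, so a Toeplitz matrix appears, scaled by factorials in rows and columns.
  Two obstacles shape the formal proof. Factorials need not be invertible in \<open>R\<close>, so
  scaling and commutation are verified term by term with integer coefficients. And contraction
  leaves a label set that no longer starts at 1, so the tree sums are defined over arbitrary finite
  label sets; the recurrence itself then shows that only the cardinality matters.\<close>

lemma por_sum:
  assumes "partially_ordered_ring P" "\<And>x. x \<in> A \<Longrightarrow> f x \<in> P"
  shows "sum f A \<in> P"
  using assms(2)
  by (induction A rule: infinite_finite_induct) (use assms(1) in \<open>auto simp: partially_ordered_ring_def\<close>)

lemma por_of_nat:
  assumes "partially_ordered_ring P"
  shows "of_nat n \<in> P"
  by (induction n) (use assms in \<open>auto simp: partially_ordered_ring_def\<close>)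

lemma por_basic:
  assumes "partially_ordered_ring P"
  shows "0 \<in> P" "1 \<in> P" "a \<in> P \<Longrightarrow> b \<in> P \<Longrightarrow> a * b \<in> P" "a \<in> P \<Longrightarrow> b \<in> P \<Longrightarrow> a + b \<in> P"
  using assms by (auto simp: partially_ordered_ring_def)

section \<open>Minors and the Cauchy--Binet formula\<close>

lemma minor_cong:
  assumes "\<And>a b. a < m \<Longrightarrow> b < m \<Longrightarrow> M (I a) (J b) = M' (I' a) (J' b)"
  shows "minor M m I J = minor M' m I' J'"
  unfolding minor_def by (intro arg_cong[where f = det] cong_mat) (use assms in auto)

lemma minor_0: "minor M 0 I J = 1"
  by (simp add: minor_def)

lemma minor_eq_sum:
  "minor M m I J = (\<Sum>p | p permutes {0..<m}. signof p * (\<Prod>a = 0..<m. M (I a) (J (p a))))"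
  unfolding minor_def
  by (subst det_def'[of _ m]) (auto intro!: sum.cong prod.cong dest: permutes_in_image)

lemma minor_transpose: "minor (\<lambda>i j. M j i) m I J = minor M m J I"
proof -
  have "mat m m (\<lambda>(a, b). M (J b) (I a)) = transpose_mat (mat m m (\<lambda>(a, b). M (J a) (I b)))"
    by (rule eq_matI) auto
  then show ?thesis
    unfolding minor_def by (simp add: det_transpose[where n = m])
qed

text \<open>Laplace expansion along the first row with a single surviving term. With the column
  version it drives the later inductions, which peel off the smallest row and column index.\<close>

lemma minor_Suc_row:
  assumes "\<And>b. b < m \<Longrightarrow> M (I 0) (J (Suc b)) = 0"
  shows "minor M (Suc m) I J = M (I 0) (J 0) * minor M m (\<lambda>a. I (Suc a)) (\<lambda>b. J (Suc b))"
proof -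
  let ?A = "mat (Suc m) (Suc m) (\<lambda>(a, b). M (I a) (J b))"
  have "det ?A = (\<Sum>j<Suc m. ?A $$ (0, j) * cofactor ?A 0 j)"
    by (rule laplace_expansion_row[of _ "Suc m"]) auto
  also have "\<dots> = ?A $$ (0, 0) * cofactor ?A 0 0"
    by (subst sum.lessThan_Suc_shift) (auto simp: assms)
  also have "cofactor ?A 0 0 = minor M m (\<lambda>a. I (Suc a)) (\<lambda>b. J (Suc b))"
    unfolding cofactor_def minor_def
    by (auto simp: mat_delete_def intro!: arg_cong[where f = det] eq_matI)
  finally show ?thesis
    by (simp add: minor_def)
qed

lemma minor_Suc_column:
  assumes "\<And>a. a < m \<Longrightarrow> M (I (Suc a)) (J 0) = 0"
  shows "minor M (Suc m) I J = M (I 0) (J 0) * minor M m (\<lambda>a. I (Suc a)) (\<lambda>b. J (Suc b))"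
  using minor_Suc_row[of m "\<lambda>i j. M j i" J I] assms unfolding minor_transpose[of M] by simp

lemma minor_identical_rows:
  assumes "a < m" "a' < m" "a \<noteq> a'" "\<And>b. b < m \<Longrightarrow> M (I a) (J b) = M (I a') (J b)"
  shows "minor M m I J = 0"
  unfolding minor_def
  by (rule det_identical_rows[OF _ assms(3,1,2)]) (use assms in \<open>auto intro!: eq_vecI simp: row_def\<close>)

lemma minor_permute_rows:
  assumes "p permutes {0..<m}"
  shows "minor M m (\<lambda>a. I (p a)) J = signof p * minor M m I J"
proof -
  have "mat m m (\<lambda>(i, j). mat m m (\<lambda>(a, b). M (I a) (J b)) $$ (p i, j))
      = mat m m (\<lambda>(a, b). M (I (p a)) (J b))"
    using permutes_in_image[OF assms] by (intro eq_matI) auto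
  then show ?thesis
    unfolding minor_def using det_permute_rows[OF _ assms, of "mat m m (\<lambda>(a, b). M (I a) (J b))"]
    by simp
qed

text \<open>Truncating the sums avoids infinite products; a minor only involves finitely many entries anyway.\<close>

definition trunc_mult ::
    "nat \<Rightarrow> (nat \<Rightarrow> nat \<Rightarrow> 'a::comm_ring_1) \<Rightarrow> (nat \<Rightarrow> nat \<Rightarrow> 'a) \<Rightarrow> nat \<Rightarrow> nat \<Rightarrow> 'a" where
  "trunc_mult N A B i k = (\<Sum>j<N. A i j * B j k)"

text \<open>Multilinearity in the rows: \<open>g\<close> records which summation index is taken in
  each row of the product. At this stage \<open>g\<close> need be neither injective nor
  increasing.\<close>

lemma minor_trunc_mult:
  "minor (trunc_mult N A B) m I J
     = (\<Sum>g\<in>{0..<m} \<rightarrow>\<^sub>E {..<N}. (\<Prod>a = 0..<m. A (I a) (g a)) * minor B m g J)"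
proof -
  have "minor (trunc_mult N A B) m I J
      = (\<Sum>p | p permutes {0..<m}. signof p *
          (\<Sum>g\<in>{0..<m} \<rightarrow>\<^sub>E {..<N}. \<Prod>a = 0..<m. A (I a) (g a) * B (g a) (J (p a))))"
    unfolding minor_eq_sum trunc_mult_def by (simp add: prod_sum_PiE)
  also have "\<dots> = (\<Sum>g\<in>{0..<m} \<rightarrow>\<^sub>E {..<N}. \<Sum>p | p permutes {0..<m}.
          signof p * (\<Prod>a = 0..<m. A (I a) (g a) * B (g a) (J (p a))))"
    by (subst sum.swap) (simp add: sum_distrib_left)
  also have "\<dots> = (\<Sum>g\<in>{0..<m} \<rightarrow>\<^sub>E {..<N}. (\<Prod>a = 0..<m. A (I a) (g a)) * minor B m g J)"
    unfolding minor_eq_sum by (simp add: sum_distrib_left prod.distrib mult_ac)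
  finally show ?thesis .
qed

text \<open>The functions \<open>g\<close> with image \<open>K\<close> are the compositions of
  \<open>e\<close> with the permutations \<open>p\<close>. Permuting the rows of the
  \<open>B\<close>-minor produces the sign of \<open>p\<close>, and these signs assemble the
  products of entries of \<open>A\<close> into the Leibniz expansion of its minor.\<close>

lemma sum_image_eq:
  assumes K: "bij_betw e {..<m} K"
  shows "(\<Sum>g | g \<in> {0..<m} \<rightarrow>\<^sub>E {..<N} \<and> g ` {0..<m} = K. (\<Prod>a = 0..<m. A (I a) (g a)) * minor B m g J)
     = (if K \<subseteq> {..<N} then minor A m I e * minor B m e J else 0)"
proof (cases "K \<subseteq> {..<N}")
  case True
  let ?G = "{g. g \<in> {0..<m} \<rightarrow>\<^sub>E {..<N} \<and> g ` {0..<m} = K}"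
  have e: "inj_on e {0..<m}" "e ` {0..<m} = K"
    using K by (auto simp: bij_betw_def atLeast0LessThan)
  have "(\<Sum>g\<in>?G. (\<Prod>a = 0..<m. A (I a) (g a)) * minor B m g J)
     = (\<Sum>p | p permutes {0..<m}. (\<Prod>a = 0..<m. A (I a) (e (p a))) * minor B m (\<lambda>a. e (p a)) J)"
  \<comment> \<open>Outside \<open>{0..<m}\<close> a permutation must be the identity, whereas a
    member of the function space must be undefined; hence the \<open>restrict\<close> in one
    direction and the \<open>if\<close> in the other.\<close>
  proof (rule sum.reindex_bij_witness[where i = "\<lambda>p. restrict (\<lambda>a. e (p a)) {0..<m}"
        and j = "\<lambda>g a. if a < m then inv_into {0..<m} e (g a) else a"], goal_cases)
    case (1 g)
    then have "e (inv_into {0..<m} e (g a)) = g a" if "a < m" for a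
      using that e by (intro f_inv_into_f) auto
    with 1 show ?case by (auto simp: restrict_def PiE_def extensional_def)
  next
    case (2 g)
    have "bij_betw g {0..<m} K"
      unfolding bij_betw_def
    proof
      show "inj_on g {0..<m}"
        by (rule eq_card_imp_inj_on) (use 2 e card_image[OF e(1)] in auto)
    qed (use 2 in auto)
    moreover have "bij_betw (inv_into {0..<m} e) K {0..<m}"
      using e by (intro bij_betw_inv_into) (auto simp: bij_betw_def)
    ultimately have "bij_betw (\<lambda>a. inv_into {0..<m} e (g a)) {0..<m} {0..<m}"
      using bij_betw_trans unfolding o_def[symmetric] by blast
    also have "?this \<longleftrightarrow> bij_betw (\<lambda>a. if a < m then inv_into {0..<m} e (g a) else a) {0..<m} {0..<m}"
      by (rule bij_betw_cong) auto
    finally show ?case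
      by (auto intro!: bij_imp_permutes)
  next
    case (3 p)
    then have p: "p permutes {0..<m}" by simp
    show ?case
    proof
      fix a
      show "(if a < m then inv_into {0..<m} e (restrict (\<lambda>a. e (p a)) {0..<m} a) else a) = p a"
        using inv_into_f_f[OF e(1), of "p a"] permutes_in_image[OF p, of a] permutes_not_in[OF p, of a]
        by auto
    qed
  next
    case (4 p)
    then have p: "p permutes {0..<m}" by simp
    have "(\<lambda>a. e (p a)) ` {0..<m} = K"
      using e(2) permutes_image[OF p] by (metis image_image)
    then show ?case using True by auto
  next
    case (5 g)
    then have *: "e (inv_into {0..<m} e (g a)) = g a" if "a < m" for a
      using that e by (intro f_inv_into_f) auto
    show ?case
      by (intro arg_cong2[where f = "(*)"] prod.cong minor_cong) (simp_all add: *)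
  qed
  also have "\<dots> = minor A m I e * minor B m e J"
    unfolding minor_eq_sum[of A] sum_distrib_right
    by (intro sum.cong refl) (auto simp: minor_permute_rows mult_ac)
  finally show ?thesis using True by simp
next
  case False
  then have "{g. g \<in> {0..<m} \<rightarrow>\<^sub>E {..<N} \<and> g ` {0..<m} = K} = {}"
    by auto
  then show ?thesis
    unfolding if_not_P[OF False] by (simp only: sum.empty)
qed

text \<open>Cauchy--Binet, reduced to what positivity needs. Group the functions \<open>g\<close> by
  their image \<open>K\<close>: if \<open>K\<close> has fewer than \<open>m\<close> elements, two
  rows of the \<open>B\<close>-minor coincide; otherwise \<open>K\<close> has an increasing
  enumeration. Only minors of the same size \<open>m\<close> occur, so the order of positivity is
  preserved.\<close>

lemma minor_trunc_mult_in:
  assumes P: "partially_ordered_ring P"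
    and AB: "\<And>K. strict_mono_on {..<m} K \<Longrightarrow> minor A m I K * minor B m K J \<in> P"
  shows "minor (trunc_mult N A B) m I J \<in> P"
proof -
  let ?F = "{0..<m} \<rightarrow>\<^sub>E {..<N}"
  let ?t = "\<lambda>g. (\<Prod>a = 0..<m. A (I a) (g a)) * minor B m g J"
  have fin: "finite ?F" by (simp add: finite_PiE)
  have "(\<Sum>g | g \<in> ?F \<and> g ` {0..<m} = K. ?t g) \<in> P" for K
  proof (cases "card K = m \<and> finite K")
    case True
    then obtain e where K: "bij_betw e {..<m} K" and e: "strict_mono_on {..<m} e"
      using ex_bij_betw_strict_mono_card by blast
    then show ?thesis
      unfolding sum_image_eq[OF K] using por_basic(1)[OF P] AB[OF e] by (cases "K \<subseteq> {..<N}") (simp_all only: if_True if_False)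
  next
    case False
    have "?t g = 0" if g: "g \<in> ?F" "g ` {0..<m} = K" for g
    proof -
      have "\<not> inj_on g {0..<m}"
        using False g(2) card_image[of g "{0..<m}"] by auto
      then obtain a a' where "a < m" "a' < m" "a \<noteq> a'" "g a = g a'"
        by (auto simp: inj_on_def)
      then have "minor B m g J = 0"
        by (intro minor_identical_rows[of a m a']) simp_all
      then show ?thesis by simp
    qed
    then show ?thesis
      using por_basic(1)[OF P] by (simp add: sum.neutral)
  qed
  then have "(\<Sum>K\<in>(\<lambda>g. g ` {0..<m}) ` ?F. \<Sum>g | g \<in> ?F \<and> g ` {0..<m} = K. ?t g) \<in> P"
    by (rule por_sum[OF P])
  then show ?thesis
    unfolding minor_trunc_mult using sum.image_gen[OF fin, of ?t "\<lambda>g. g ` {0..<m}"] by simp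
qed

lemma totally_positive_trunc_mult:
  assumes "partially_ordered_ring P" "totally_positive P r A" "totally_positive P r B"
  shows "totally_positive P r (trunc_mult N A B)"
  unfolding totally_positive_def
proof (intro allI impI)
  fix m and I J :: "nat \<Rightarrow> nat" assume "enat m \<le> r" "strict_mono_on {..<m} I" "strict_mono_on {..<m} J"
  then show "minor (trunc_mult N A B) m I J \<in> P"
    using assms(2,3) by (intro minor_trunc_mult_in[OF assms(1)] por_basic[OF assms(1)])
      (auto simp: totally_positive_def)
qed

lemma totally_positive_transpose:
  "totally_positive P r M \<Longrightarrow> totally_positive P r (\<lambda>i j. M j i)"
  unfolding totally_positive_def minor_transpose[of M] by blast

section \<open>Totally positive matrices\<close>

text \<open>Scaling row \<open>n\<close> by \<open>n!\<close> and column \<open>k\<close> by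
  \<open>1/k!\<close> multiplies each minor by one constant. Since \<open>R\<close> may lack the
  inverses, the constant has to be a natural number: a nonzero Leibniz term has
  \<open>J (p a) \<le> I a\<close> throughout, so every single quotient is exact, and their product
  does not depend on \<open>p\<close>.\<close>

lemma totally_positive_scale:
  assumes P: "partially_ordered_ring P" and A: "totally_positive P r A"
    and lower: "\<And>n k. n < k \<Longrightarrow> A n k = 0"
  shows "totally_positive P r (\<lambda>n k. of_nat (fact n div fact k) * A n k)"
  unfolding totally_positive_def
proof (intro allI impI)
  fix m and I J :: "nat \<Rightarrow> nat"
  assume m: "enat m \<le> r" "strict_mono_on {..<m} I" "strict_mono_on {..<m} J"
  define c :: nat where "c = (\<Prod>a = 0..<m. fact (I a)) div (\<Prod>a = 0..<m. fact (J a))"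
  let ?A' = "\<lambda>n k. of_nat (fact n div fact k) * A n k"
  have "(\<Prod>a = 0..<m. ?A' (I a) (J (p a))) = of_nat c * (\<Prod>a = 0..<m. A (I a) (J (p a)))"
    if p: "p permutes {0..<m}" for p
  proof (cases "\<forall>a<m. J (p a) \<le> I a")
    case True
    have "(\<Prod>a = 0..<m. fact (I a) div fact (J (p a)) :: nat) * (\<Prod>a = 0..<m. fact (J (p a)))
        = (\<Prod>a = 0..<m. fact (I a))"
      unfolding prod.distrib[symmetric] using True by (intro prod.cong) (auto simp: fact_dvd)
    moreover have "(\<Prod>a = 0..<m. fact (J (p a))) = (\<Prod>a = 0..<m. fact (J a) :: nat)"
      using prod.permute[OF p, of "\<lambda>a. fact (J a) :: nat"] by (simp add: o_def)
    moreover have "(\<Prod>a = 0..<m. fact (J a)) > (0 :: nat)"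
      by (simp add: prod_pos)
    ultimately have "c = (\<Prod>a = 0..<m. fact (I a) div fact (J (p a)))"
      unfolding c_def by (metis nonzero_mult_div_cancel_right less_not_refl)
    then show ?thesis
      by (simp add: prod.distrib)
  next
    case False
    then obtain a where "a < m" "I a < J (p a)" by force
    then have "(\<Prod>a = 0..<m. A (I a) (J (p a))) = 0" "(\<Prod>a = 0..<m. ?A' (I a) (J (p a))) = 0"
      using lower by (auto intro!: prod_zero bexI[of _ a])
    then show ?thesis by simp
  qed
  then have "minor ?A' m I J = of_nat c * minor A m I J"
    unfolding minor_eq_sum sum_distrib_left by (intro sum.cong) (auto simp: mult_ac)
  then show "minor ?A' m I J \<in> P"
    using por_of_nat[OF P] por_basic(3)[OF P] A m by (auto simp: totally_positive_def)
qed

lemma strict_mono_on_Suc_shift: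
  "strict_mono_on {..<Suc m} I \<Longrightarrow> strict_mono_on {..<m} (\<lambda>a. I (Suc a))"
  by (auto simp: strict_mono_on_def)

lemma strict_mono_on_0_less:
  "strict_mono_on {..<Suc m} I \<Longrightarrow> a < m \<Longrightarrow> I 0 < I (Suc a)"
  by (auto simp: strict_mono_on_def)

lemma strict_mono_on_pos:
  fixes I :: "nat \<Rightarrow> nat"
  assumes "strict_mono_on {..<m} I" "0 < I 0" "a < m"
  shows "0 < I a"
proof (cases a)
  case (Suc a')
  then have "I 0 < I a"
    using assms(1,3) by (auto simp: strict_mono_on_def)
  then show ?thesis by simp
qed (use assms in simp)

text \<open>Pulling \<open>c\<close> out of the first row leaves two identical rows. No cancellation
  in the ring is involved.\<close>

lemma minor_eq_0_proportional_rows: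
  assumes "0 < m" "\<And>b. b \<le> m \<Longrightarrow> M (I 0) (J b) = c * M (I (Suc 0)) (J b)"
  shows "minor M (Suc m) I J = 0"
proof -
  let ?I = "\<lambda>a. if a = 0 then I (Suc 0) else I a"
  have "(\<Prod>a = 0..<Suc m. M (I a) (J (p a))) = c * (\<Prod>a = 0..<Suc m. M (?I a) (J (p a)))"
    if "p permutes {0..<Suc m}" for p
  proof -
    have "p 0 \<le> m"
      using permutes_in_image[OF that, of 0] by simp
    then show ?thesis
      using assms(2) by (simp add: prod.atLeast0_lessThan_Suc_shift mult.assoc del: prod.op_ivl_Suc)
  qed
  then have "minor M (Suc m) I J = c * minor M (Suc m) ?I J"
    unfolding minor_eq_sum sum_distrib_left by (intro sum.cong) (auto simp: mult_ac)
  also have "minor M (Suc m) ?I J = 0"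
    by (rule minor_identical_rows[of 0 _ 1]) (use assms(1) in auto)
  finally show ?thesis by simp
qed

text \<open>The upper-triangular form allows a dichotomy. If \<open>J 0 < I 1\<close>, the first
  column vanishes below its top entry and can be split off. Otherwise every chosen column is at
  least \<open>I 1\<close>, so the first row is \<open>y ^ (I 1 - I 0)\<close> times the second and
  the minor vanishes.\<close>

lemma minor_geometric_in:
  assumes P: "partially_ordered_ring P" and y: "y \<in> P"
  shows "strict_mono_on {..<m} I \<Longrightarrow> strict_mono_on {..<m} J \<Longrightarrow>
    minor (\<lambda>k n. if k \<le> n then y ^ (n - k) else 0) m I J \<in> P"
proof (induction m arbitrary: I J)
  case 0
  then show ?case using por_basic(2)[OF P] by (simp add: minor_0)
next
  case (Suc m)
  let ?M = "\<lambda>k n. if k \<le> n then y ^ (n - k) else 0"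
  have pow: "y ^ i \<in> P" for i
    by (induction i) (auto simp: por_basic[OF P] y)
  show ?case
  proof (cases "m = 0 \<or> J 0 < I (Suc 0)")
    case True
    have "?M (I (Suc a)) (J 0) = 0" if "a < m" for a
    proof -
      have "I (Suc 0) \<le> I (Suc a)"
        using that Suc.prems(1) by (cases a) (auto simp: strict_mono_on_def intro!: less_imp_le)
      then show ?thesis using True that by auto
    qed
    then have "minor ?M (Suc m) I J
        = ?M (I 0) (J 0) * minor ?M m (\<lambda>a. I (Suc a)) (\<lambda>b. J (Suc b))"
      by (rule minor_Suc_column)
    also have "\<dots> \<in> P"
      using Suc pow by (intro por_basic(3)[OF P]) (auto simp: strict_mono_on_Suc_shift por_basic[OF P])
    finally show ?thesis .
  next
    case False
    have "?M (I 0) (J b) = y ^ (I (Suc 0) - I 0) * ?M (I (Suc 0)) (J b)" if "b \<le> m" for b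
    proof -
      have "I 0 < I (Suc 0)"
        using Suc.prems(1) False by (auto simp: strict_mono_on_def)
      moreover have "J 0 \<le> J b"
        using Suc.prems(2) that by (cases b) (auto simp: strict_mono_on_def intro!: less_imp_le)
      ultimately show ?thesis
        using False by (auto simp flip: power_add)
    qed
    then have "minor ?M (Suc m) I J = 0"
      using False by (intro minor_eq_0_proportional_rows) auto
    then show ?thesis using por_basic(1)[OF P] by simp
  qed
qed

lemma totally_positive_geometric:
  assumes "partially_ordered_ring P" "y \<in> P"
  shows "totally_positive P r (\<lambda>n k. if k \<le> n then y ^ (n - k) else 0)"
  using assms
  by (intro totally_positive_transpose[where M = "\<lambda>k n. if k \<le> n then y ^ (n - k) else 0"])
    (simp add: totally_positive_def minor_geometric_in)

text \<open>The matrix \<open>\<Delta> + x I\<close> of the overview; \<open>x = 0\<close> gives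
  \<open>\<Delta>\<close> itself.\<close>

definition bidiagonal :: "'a::comm_ring_1 \<Rightarrow> nat \<Rightarrow> nat \<Rightarrow> 'a" where
  "bidiagonal x n k = (if k = n then x else if k = Suc n then 1 else 0)"

text \<open>If \<open>J 0 \<le> I 0\<close>, all later rows lie strictly below the diagonal in
  column \<open>J 0\<close>. If \<open>J 0 > I 0\<close>, all later columns lie beyond the
  superdiagonal in row \<open>I 0\<close>. In both cases the corner entry splits off.\<close>

lemma minor_bidiagonal_in:
  assumes P: "partially_ordered_ring P" and x: "x \<in> P"
  shows "strict_mono_on {..<m} I \<Longrightarrow> strict_mono_on {..<m} J \<Longrightarrow> minor (bidiagonal x) m I J \<in> P"
proof (induction m arbitrary: I J)
  case 0
  then show ?case using por_basic(2)[OF P] by (simp add: minor_0)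
next
  case (Suc m)
  have I: "I 0 < I (Suc a)" and J: "J 0 < J (Suc a)" if "a < m" for a
    using Suc.prems that strict_mono_on_0_less by blast+
  have "minor (bidiagonal x) (Suc m) I J
      = bidiagonal x (I 0) (J 0) * minor (bidiagonal x) m (\<lambda>a. I (Suc a)) (\<lambda>b. J (Suc b))"
  proof (cases "J 0 \<le> I 0")
    case True
    then show ?thesis
      using I by (intro minor_Suc_column) (fastforce simp: bidiagonal_def)
  next
    case False
    then show ?thesis
      using J by (intro minor_Suc_row) (fastforce simp: bidiagonal_def)
  qed
  also have "\<dots> \<in> P"
  proof (rule por_basic(3)[OF P])
    show "bidiagonal x (I 0) (J 0) \<in> P"
      using x by (simp add: bidiagonal_def por_basic[OF P])
  qed (intro Suc strict_mono_on_Suc_shift)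
  finally show ?case .
qed

lemma totally_positive_bidiagonal:
  assumes "partially_ordered_ring P" "x \<in> P"
  shows "totally_positive P r (bidiagonal x)"
  using assms by (simp add: totally_positive_def minor_bidiagonal_in)

section \<open>Production matrices\<close>

text \<open>Only minors from the first \<open>n\<close> rows are considered, so that positivity of
  an output matrix can be proved by induction on the number of rows.\<close>

definition totally_positive_rows ::
    "'a::comm_ring_1 set \<Rightarrow> enat \<Rightarrow> nat \<Rightarrow> (nat \<Rightarrow> nat \<Rightarrow> 'a) \<Rightarrow> bool" where
  "totally_positive_rows P r n M \<longleftrightarrow>
     (\<forall>m I J. enat m \<le> r \<longrightarrow> strict_mono_on {..<m} I \<longrightarrow> strict_mono_on {..<m} J \<longrightarrow>
        (\<forall>a<m. I a < n) \<longrightarrow> minor M m I J \<in> P)"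

lemma totally_positive_iff_rows:
  "totally_positive P r M \<longleftrightarrow> (\<forall>n. totally_positive_rows P r n M)"
proof
  assume *: "\<forall>n. totally_positive_rows P r n M"
  show "totally_positive P r M"
    unfolding totally_positive_def
  proof (intro allI impI)
    fix m and I J :: "nat \<Rightarrow> nat"
    assume "enat m \<le> r" "strict_mono_on {..<m} I" "strict_mono_on {..<m} J"
    moreover have "\<forall>a<m. I a < Suc (\<Sum>a<m. I a)"
      by (auto simp: less_Suc_eq_le intro!: member_le_sum)
    ultimately show "minor M m I J \<in> P"
      using * unfolding totally_positive_rows_def by blast
  qed
qed (auto simp: totally_positive_def totally_positive_rows_def)

lemma totally_positive_rows_trunc_mult:
  assumes "partially_ordered_ring P" "totally_positive_rows P r n A" "totally_positive P r B"
  shows "totally_positive_rows P r n (trunc_mult N A B)"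
  unfolding totally_positive_rows_def
proof (intro allI impI)
  fix m and I J :: "nat \<Rightarrow> nat"
  assume "enat m \<le> r" "strict_mono_on {..<m} I" "strict_mono_on {..<m} J" "\<forall>a<m. I a < n"
  then show "minor (trunc_mult N A B) m I J \<in> P"
    using assms(2,3) by (intro minor_trunc_mult_in[OF assms(1)] por_basic[OF assms(1)])
      (auto simp: totally_positive_def totally_positive_rows_def)
qed

definition prepend_unit_row :: "(nat \<Rightarrow> nat \<Rightarrow> 'a::comm_ring_1) \<Rightarrow> nat \<Rightarrow> nat \<Rightarrow> 'a" where
  "prepend_unit_row M i k = (case i of 0 \<Rightarrow> if k = 0 then 1 else 0 | Suc i' \<Rightarrow> M i' k)"

definition prepend_zero_column :: "(nat \<Rightarrow> nat \<Rightarrow> 'a::comm_ring_1) \<Rightarrow> nat \<Rightarrow> nat \<Rightarrow> 'a" where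
  "prepend_zero_column M i k = (case k of 0 \<Rightarrow> 0 | Suc k' \<Rightarrow> M i k')"

lemma strict_mono_on_pred:
  assumes "strict_mono_on {..<m} I" "\<And>a. a < m \<Longrightarrow> 0 < I a"
  shows "strict_mono_on {..<m} (\<lambda>a. I a - Suc 0)"
  using assms by (force simp: strict_mono_on_def intro!: diff_less_mono Suc_leI)

text \<open>A minor avoiding the new row is a minor of \<open>M\<close> with shifted row indices. A
  minor using it has a first row that can be nonzero only in its first entry, which is 0 or 1, so
  expansion leads back to the first case.\<close>

lemma totally_positive_rows_prepend_unit_row:
  assumes P: "partially_ordered_ring P" and M: "totally_positive_rows P r n M"
  shows "totally_positive_rows P r (Suc n) (prepend_unit_row M)"
  unfolding totally_positive_rows_def
proof (intro allI impI)
  fix m and I J :: "nat \<Rightarrow> nat"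
  assume m: "enat m \<le> r" "strict_mono_on {..<m} I" "strict_mono_on {..<m} J" "\<forall>a<m. I a < Suc n"
  have pred: "minor (prepend_unit_row M) m' I' J' \<in> P"
    if "m' \<le> m" "strict_mono_on {..<m'} I'" "strict_mono_on {..<m'} J'"
      "\<And>a. a < m' \<Longrightarrow> 0 < I' a" "\<And>a. a < m' \<Longrightarrow> I' a < Suc n" for m' and I' J' :: "nat \<Rightarrow> nat"
  proof -
    have "minor (prepend_unit_row M) m' I' J' = minor M m' (\<lambda>a. I' a - Suc 0) J'"
      by (intro minor_cong) (auto simp: prepend_unit_row_def dest: that(4) split: nat.split)
    moreover have "enat m' \<le> r"
      using that(1) m(1) by (meson enat_ord_simps(1) order_trans)
    moreover have "I' a - Suc 0 < n" if "a < m'" for a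
      using \<open>\<And>a. a < m' \<Longrightarrow> 0 < I' a\<close>[OF that] \<open>\<And>a. a < m' \<Longrightarrow> I' a < Suc n\<close>[OF that] by linarith
    ultimately show ?thesis
      using M strict_mono_on_pred[OF that(2,4)] that(3) unfolding totally_positive_rows_def by simp
  qed
  show "minor (prepend_unit_row M) m I J \<in> P"
  proof (cases "m = 0 \<or> 0 < I 0")
    case True
    then show ?thesis
    proof (intro pred)
      fix a assume "a < m"
      then show "0 < I a"
        using True strict_mono_on_pos[OF m(2)] by auto
    qed (use m in auto)
  next
    case False
    then obtain m' where m': "m = Suc m'" and I0: "I 0 = 0"
      by (cases m) auto
    have "J 0 < J (Suc b)" "I 0 < I (Suc b)" if "b < m'" for b
      using m that strict_mono_on_0_less unfolding m' by blast+
    then have "minor (prepend_unit_row M) m I J = prepend_unit_row M (I 0) (J 0) *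
        minor (prepend_unit_row M) m' (\<lambda>a. I (Suc a)) (\<lambda>b. J (Suc b))"
      unfolding m' by (intro minor_Suc_row) (force simp: prepend_unit_row_def I0)
    also have "\<dots> \<in> P"
    proof (intro por_basic(3)[OF P] pred)
      show "prepend_unit_row M (I 0) (J 0) \<in> P"
        by (simp add: prepend_unit_row_def I0 por_basic[OF P])
    qed (use m in \<open>auto simp: m' strict_mono_on_Suc_shift dest: strict_mono_on_0_less[rotated]\<close>)
    finally show ?thesis .
  qed
qed

lemma totally_positive_prepend_unit_row:
  assumes P: "partially_ordered_ring P" and M: "totally_positive P r M"
  shows "totally_positive P r (prepend_unit_row M)"
proof -
  have "totally_positive_rows P r n (prepend_unit_row M)" for n
  proof -
    have "totally_positive_rows P r (Suc n) (prepend_unit_row M)"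
      using M by (intro totally_positive_rows_prepend_unit_row[OF P]) (simp add: totally_positive_iff_rows)
    then show ?thesis
      unfolding totally_positive_rows_def by (meson less_SucI)
  qed
  then show ?thesis by (simp add: totally_positive_iff_rows)
qed

lemma totally_positive_rows_prepend_zero_column:
  assumes P: "partially_ordered_ring P" and M: "totally_positive_rows P r n M"
  shows "totally_positive_rows P r n (prepend_zero_column M)"
  unfolding totally_positive_rows_def
proof (intro allI impI)
  fix m and I J :: "nat \<Rightarrow> nat"
  assume m: "enat m \<le> r" "strict_mono_on {..<m} I" "strict_mono_on {..<m} J" "\<forall>a<m. I a < n"
  show "minor (prepend_zero_column M) m I J \<in> P"
  proof (cases "m = 0 \<or> 0 < J 0")
    case True
    have J: "0 < J a" if "a < m" for a
      using True strict_mono_on_pos[OF m(3) _ that] that by auto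
    then have "minor (prepend_zero_column M) m I J = minor M m I (\<lambda>a. J a - Suc 0)"
      by (intro minor_cong) (auto simp: prepend_zero_column_def dest: J split: nat.split)
    then show ?thesis
      using M m strict_mono_on_pred[OF m(3) J] by (simp add: totally_positive_rows_def)
  next
    case False
    then obtain m' where m': "m = Suc m'" and J0: "J 0 = 0"
      by (cases m) auto
    have "minor (prepend_zero_column M) m I J = 0"
      unfolding m' by (subst minor_Suc_column) (auto simp: prepend_zero_column_def J0)
    then show ?thesis by (simp add: por_basic[OF P])
  qed
qed

text \<open>Row \<open>n\<close> is the zeroth row of the \<open>n\<close>-th power of
  \<open>A\<close>, with every intermediate index bounded by \<open>N\<close>.\<close>

fun trunc_output :: "nat \<Rightarrow> (nat \<Rightarrow> nat \<Rightarrow> 'a::comm_ring_1) \<Rightarrow> nat \<Rightarrow> nat \<Rightarrow> 'a" where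
  "trunc_output N A 0 k = (if k = 0 then 1 else 0)"
| "trunc_output N A (Suc n) k = (\<Sum>j<N. trunc_output N A n j * A j k)"

text \<open>The recursion for the rows is a matrix identity with \<open>?T\<close> on both sides:
  \<open>?T\<close> is the block sum of 1 and \<open>?T\<close>, times \<open>A\<close> with a unit
  row on top. This is not circular, because row \<open>i + 1\<close> on the left involves only row
  \<open>i\<close> of \<open>?T\<close> on the right. The added row and column explain the bound
  \<open>Suc N\<close>.\<close>

lemma totally_positive_trunc_output:
  assumes P: "partially_ordered_ring P" and A: "totally_positive P r A"
  shows "totally_positive P r (trunc_output N A)"
proof -
  let ?T = "trunc_output N A"
  \<comment> \<open>This factorization reduces the first \<open>n + 1\<close> rows of \<open>?T\<close> to its first \<open>n\<close> rows.\<close>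
  have T: "?T = trunc_mult (Suc N) (prepend_unit_row (prepend_zero_column ?T)) (prepend_unit_row A)"
  proof (intro ext)
    fix i k
    show "?T i k = trunc_mult (Suc N) (prepend_unit_row (prepend_zero_column ?T)) (prepend_unit_row A) i k"
      by (cases i) (simp_all add: trunc_mult_def prepend_unit_row_def prepend_zero_column_def
          sum.lessThan_Suc_shift del: sum.lessThan_Suc)
  qed
  have "totally_positive_rows P r n ?T" for n
  proof (induction n)
    case 0
    show ?case
      unfolding totally_positive_rows_def
    proof (intro allI impI)
      fix m and I J :: "nat \<Rightarrow> nat" assume "\<forall>a<m. I a < 0"
      then have "m = 0" by (cases m) auto
      then show "minor ?T m I J \<in> P" by (simp add: minor_0 por_basic[OF P])
    qed
  next
    case (Suc n)
    then show ?case
      by (subst T) (intro totally_positive_rows_trunc_mult totally_positive_rows_prepend_unit_row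
          totally_positive_rows_prepend_zero_column totally_positive_prepend_unit_row P A)
  qed
  then show ?thesis by (simp add: totally_positive_iff_rows)
qed

text \<open>The (0,0) entry of a power splits as a row of \<open>A^i\<close> times a column of
  \<open>A^j\<close>; that column is the zeroth row of the \<open>j\<close>-th power of the
  transpose.\<close>

lemma trunc_output_add:
  assumes "0 < N"
  shows "trunc_output N A (i + j) 0 = (\<Sum>l<N. trunc_output N A i l * trunc_output N (\<lambda>i j. A j i) j l)"
proof (induction j arbitrary: i)
  case 0
  have "(\<Sum>l<N. trunc_output N A i l * trunc_output N (\<lambda>i j. A j i) 0 l)
      = (\<Sum>l<N. if l = 0 then trunc_output N A i 0 else 0)"
    by (intro sum.cong) auto
  then show ?case using assms by (simp add: sum.delta)
next
  case (Suc j)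
  have "trunc_output N A (i + Suc j) 0
      = (\<Sum>l<N. \<Sum>q<N. trunc_output N A i q * A q l * trunc_output N (\<lambda>i j. A j i) j l)"
    using Suc[of "Suc i"] by (simp add: sum_distrib_right)
  also have "\<dots> = (\<Sum>q<N. trunc_output N A i q * trunc_output N (\<lambda>i j. A j i) (Suc j) q)"
    by (subst sum.swap) (simp add: sum_distrib_left mult_ac)
  finally show ?case .
qed

text \<open>By the splitting of powers, the Hankel matrix is the output matrix of \<open>A\<close>
  times the transposed output matrix of the transpose of \<open>A\<close>. Both factors are totally
  positive.\<close>

lemma totally_positive_hankel_trunc_output:
  assumes P: "partially_ordered_ring P" and A: "totally_positive P r A" and N: "0 < N"
  shows "totally_positive P r (\<lambda>i j. trunc_output N A (i + j) 0)"
proof -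
  have "(\<lambda>i j. trunc_output N A (i + j) 0)
      = trunc_mult N (trunc_output N A) (\<lambda>i j. trunc_output N (\<lambda>i j. A j i) j i)"
    by (simp add: trunc_mult_def trunc_output_add[OF N] fun_eq_iff)
  then show ?thesis
    using totally_positive_trunc_mult[OF P] totally_positive_trunc_output[OF P] A totally_positive_transpose
    by metis
qed

section \<open>The matrices attached to the tree recurrence\<close>

definition scaled_toeplitz :: "(nat \<Rightarrow> 'a::comm_ring_1) \<Rightarrow> nat \<Rightarrow> nat \<Rightarrow> 'a" where
  "scaled_toeplitz a n k = of_nat (fact n div fact k) * toeplitz_matrix a n k"

definition binomial_matrix :: "'a::comm_ring_1 \<Rightarrow> nat \<Rightarrow> nat \<Rightarrow> 'a" where
  "binomial_matrix x n k = of_nat (n choose k) * x ^ (n - k)"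

lemma scaled_toeplitz_eq_0: "n < k \<Longrightarrow> scaled_toeplitz a n k = 0"
  by (simp add: scaled_toeplitz_def toeplitz_matrix_def)

lemma binomial_matrix_eq_0: "n < k \<Longrightarrow> binomial_matrix x n k = 0"
  by (simp add: binomial_matrix_def binomial_eq_0)

lemma totally_positive_scaled_toeplitz:
  assumes "partially_ordered_ring P" "toeplitz_totally_positive P r a"
  shows "totally_positive P r (scaled_toeplitz a)"
  using totally_positive_scale[OF assms(1), of r "toeplitz_matrix a"] assms(2)
  by (simp add: toeplitz_totally_positive_def scaled_toeplitz_def[abs_def] toeplitz_matrix_def)

lemma toeplitz_totally_positive_power:
  assumes "partially_ordered_ring P" "y \<in> P"
  shows "toeplitz_totally_positive P r (\<lambda>n. y ^ n)"
  using totally_positive_geometric[OF assms]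
  by (simp add: toeplitz_totally_positive_def toeplitz_matrix_def[abs_def])

text \<open>Both sides are \<open>n! / (k! (j-k)!)\<close>. The index \<open>n + k - j\<close> is
  the reflection that matches the terms of the two products in the commutation below.\<close>

lemma fact_div_choose:
  assumes "k \<le> j" "j \<le> n"
  shows "(fact n div fact j) * (j choose k) = (n choose (n + k - j)) * (fact (n + k - j) div fact k :: nat)"
proof -
  obtain i l where j: "j = k + i" and n: "n = k + i + l"
    using assms by (metis le_Suc_ex)
  have "real ((fact n div fact j) * (j choose k))
      = real ((n choose (n + k - j)) * (fact (n + k - j) div fact k))"
    unfolding j n by (simp add: real_of_nat_div fact_dvd binomial_fact field_simps)
  then show ?thesis by linarith
qed

text \<open>Formally \<open>binomial_matrix x\<close> is the scaled Toeplitz matrix of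
  \<open>x^m / m!\<close>, and triangular Toeplitz matrices commute under the same scaling. As
  \<open>m!\<close> may not be invertible, the convolution is reversed explicitly by
  \<open>j \<mapsto> n + k - j\<close>.\<close>

lemma scaled_toeplitz_binomial_commute:
  assumes "n < N"
  shows "(\<Sum>j<N. scaled_toeplitz a n j * binomial_matrix x j k)
     = (\<Sum>j<N. binomial_matrix x n j * scaled_toeplitz a j k)"
proof -
  have restr: "(\<Sum>j<N. f j) = (\<Sum>j\<in>{k..n}. f j)" if "\<And>j. j < k \<or> n < j \<Longrightarrow> f j = 0" for f :: "nat \<Rightarrow> 'a"
    by (rule sum.mono_neutral_right) (use assms that in auto)
  have "(\<Sum>j<N. scaled_toeplitz a n j * binomial_matrix x j k)
      = (\<Sum>j\<in>{k..n}. scaled_toeplitz a n j * binomial_matrix x j k)"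
    by (rule restr) (auto simp: scaled_toeplitz_eq_0 binomial_matrix_eq_0)
  also have "\<dots> = (\<Sum>j\<in>{k..n}. binomial_matrix x n j * scaled_toeplitz a j k)"
  proof (rule sum.reindex_bij_witness[where i = "\<lambda>j. n + k - j" and j = "\<lambda>j. n + k - j"])
    fix j assume j: "j \<in> {k..n}"
    have "scaled_toeplitz a n j * binomial_matrix x j k
        = of_nat ((fact n div fact j) * (j choose k)) * (a (n - j) * x ^ (j - k))"
      using j by (simp add: scaled_toeplitz_def binomial_matrix_def toeplitz_matrix_def mult_ac)
    also have "\<dots> = of_nat ((n choose (n + k - j)) * (fact (n + k - j) div fact k)) * (a (n - j) * x ^ (j - k))"
      using j by (subst fact_div_choose) auto
    also have "\<dots> = binomial_matrix x n (n + k - j) * scaled_toeplitz a (n + k - j) k"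
      using j le_add_diff[of j n k] by (simp add: scaled_toeplitz_def binomial_matrix_def toeplitz_matrix_def mult_ac)
    finally show "binomial_matrix x n (n + k - j) * scaled_toeplitz a (n + k - j) k
        = scaled_toeplitz a n j * binomial_matrix x j k" by simp
  qed auto
  also have "\<dots> = (\<Sum>j<N. binomial_matrix x n j * scaled_toeplitz a j k)"
    by (rule restr[symmetric]) (auto simp: scaled_toeplitz_eq_0 binomial_matrix_eq_0)
  finally show ?thesis .
qed

text \<open>Pascal's rule; read as a statement about row shifts, it is the identity
  \<open>\<Delta> B\<^sub>x = B\<^sub>x (\<Delta> + x I)\<close>.\<close>

lemma binomial_matrix_Suc:
  "binomial_matrix x (Suc n) k = x * binomial_matrix x n k + (case k of 0 \<Rightarrow> 0 | Suc k' \<Rightarrow> binomial_matrix x n k')"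
proof (cases k)
  case (Suc k')
  show ?thesis
  proof (cases "n \<le> k'")
    case True
    then show ?thesis
      by (cases "n = k'") (auto simp: Suc binomial_matrix_def binomial_eq_0)
  next
    case False
    then have "n - k' = Suc (n - Suc k')" by simp
    then show ?thesis
      by (simp add: Suc binomial_matrix_def algebra_simps)
  qed
qed (simp add: binomial_matrix_def)

section \<open>Solving the recurrence by a production matrix\<close>

locale tree_recurrence =
  fixes \<phi> :: "nat \<Rightarrow> 'a::comm_ring_1" and y :: 'a and t :: "nat \<Rightarrow> nat \<Rightarrow> 'a"
  assumes t_0: "t 0 k = (if k = 0 then 1 else 0)"
    and t_eq_0: "n < k \<Longrightarrow> t n k = 0"
    and t_Suc: "t (Suc n) k = (case k of 0 \<Rightarrow> 0 | Suc i \<Rightarrow> \<Sum>j\<le>n. t n j * scaled_toeplitz \<phi> j i)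
      + of_nat (Suc k) * y * t (Suc n) (Suc k)"
begin

abbreviation "M\<phi> \<equiv> scaled_toeplitz \<phi>"
abbreviation "My \<equiv> scaled_toeplitz (\<lambda>n. y ^ n)"

text \<open>The product of \<open>t\<close> with \<open>M\<phi>\<close>, which supplies the
  inhomogeneous term of the recurrence.\<close>

definition "u n i = (\<Sum>j\<le>n. t n j * M\<phi> j i)"

lemma u_eq_0: "n < i \<Longrightarrow> u n i = 0"
  by (auto simp: u_def scaled_toeplitz_eq_0 intro!: sum.neutral)

lemma u_eq_sum:
  assumes "n < N"
  shows "u n i = (\<Sum>j<N. t n j * M\<phi> j i)"
  unfolding u_def by (rule sum.mono_neutral_left) (use assms in \<open>auto simp: t_eq_0\<close>)

text \<open>Below the diagonal, \<open>My\<close> satisfies the homogeneous recurrence in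
  \<open>k\<close>. In matrix terms \<open>My\<close> is the inverse of \<open>I - y L\<close>,
  where \<open>L\<close> has the entries \<open>k + 1\<close> in positions
  \<open>(k + 1, k)\<close>.\<close>

lemma My_Suc_column:
  assumes "Suc k \<le> n"
  shows "My n k = of_nat (Suc k) * y * My n (Suc k)"
proof -
  have "(fact n div fact k :: nat) = Suc k * (fact n div fact (Suc k))"
  proof -
    obtain q where q: "fact n = fact (Suc k) * (q::nat)"
      using fact_dvd[OF assms] by (metis dvdE)
    have "fact (Suc k) = fact k * Suc k" by simp
    then have "fact n div fact k = Suc k * q"
      unfolding q by (metis mult.assoc fact_nonzero nonzero_mult_div_cancel_left)
    moreover have "fact n div fact (Suc k) = q"
      unfolding q by simp
    ultimately show ?thesis by simp
  qed
  moreover have "y ^ (n - k) = y * y ^ (n - Suc k)"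
    using assms by (simp add: Suc_diff_Suc flip: power_Suc)
  ultimately show ?thesis
    using assms by (simp add: scaled_toeplitz_def toeplitz_matrix_def mult_ac
        del: fact_Suc of_nat_Suc mult_Suc mult_Suc_right)
qed

text \<open>The recurrence has row \<open>Suc n\<close> on both sides but refers to column
  \<open>k + 1\<close>, so it is unrolled by downward induction from \<open>k = Suc n\<close>,
  beyond which the row vanishes. The row index \<open>Suc i\<close> of \<open>My\<close> is the
  effect of \<open>\<Delta>\<close>.\<close>

lemma t_Suc_eq_u: "t (Suc n) k = (\<Sum>i\<le>n. u n i * My (Suc i) k)"
proof (cases "k \<le> Suc n")
  case True
  then show ?thesis
  proof (induction rule: inc_induct)
    case base
    have "t (Suc n) (Suc n) = u n n"
      by (subst t_Suc) (simp add: t_eq_0 u_def)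
    moreover have "(\<Sum>i\<le>n. u n i * My (Suc i) (Suc n)) = (\<Sum>i\<in>{n}. u n i * My (Suc i) (Suc n))"
      by (rule sum.mono_neutral_right) (auto simp: scaled_toeplitz_eq_0)
    ultimately show ?case
      by (simp add: scaled_toeplitz_def toeplitz_matrix_def)
  next
    case (step k)
    \<comment> \<open>The diagonal correction 1 is what reproduces the inhomogeneous term
      \<open>u n (k - 1)\<close>.\<close>
    have My: "My (Suc i) k = of_nat (Suc k) * y * My (Suc i) (Suc k) + (if Suc i = k then 1 else 0)"
      for i
    proof (cases "Suc k \<le> Suc i")
      case True
      then show ?thesis
        unfolding My_Suc_column[OF True] by auto
    next
      case False
      then show ?thesis
        by (cases "Suc i = k") (auto simp: scaled_toeplitz_eq_0 scaled_toeplitz_def toeplitz_matrix_def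
            simp del: fact_Suc)
    qed
    have "(\<Sum>i\<le>n. u n i * My (Suc i) k)
        = of_nat (Suc k) * y * (\<Sum>i\<le>n. u n i * My (Suc i) (Suc k))
          + (\<Sum>i\<le>n. if Suc i = k then u n i else 0)"
      unfolding My sum_distrib_left sum.distrib[symmetric]
      by (rule sum.cong) (auto simp: algebra_simps)
    also have "(\<Sum>i\<le>n. if Suc i = k then u n i else 0) = (case k of 0 \<Rightarrow> 0 | Suc i \<Rightarrow> u n i)"
      using step by (auto split: nat.split simp: sum.delta)
    finally show ?case
      using step.IH t_Suc[of n k] by (simp add: u_def add.commute split: nat.split)
  qed
next
  case False
  then show ?thesis
    by (auto simp: t_eq_0 scaled_toeplitz_eq_0 intro!: sum.neutral)
qed

text \<open>The product \<open>t B\<^sub>x\<close>. One matrix serves both parts of the theorem: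
  \<open>x = 0\<close> gives back \<open>t\<close>, and its zeroth column consists of the row
  polynomials.\<close>

definition "s x n k = (\<Sum>j\<le>n. t n j * binomial_matrix x j k)"

lemma s_eq_sum:
  assumes "n < N"
  shows "s x n k = (\<Sum>j<N. t n j * binomial_matrix x j k)"
  unfolding s_def by (rule sum.mono_neutral_left) (use assms in \<open>auto simp: t_eq_0\<close>)

definition "production N x = trunc_mult N M\<phi> (trunc_mult N (bidiagonal x) My)"

lemma bidiagonal_mult:
  assumes "Suc l < N"
  shows "trunc_mult N (bidiagonal x) A l k = x * A l k + A (Suc l) k"
proof -
  have "trunc_mult N (bidiagonal x) A l k = (\<Sum>j\<in>{l, Suc l}. bidiagonal x l j * A j k)"
    unfolding trunc_mult_def
    by (rule sum.mono_neutral_right) (use assms in \<open>auto simp: bidiagonal_def\<close>)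
  then show ?thesis by (simp add: bidiagonal_def)
qed

text \<open>Moves \<open>B\<^sub>x\<close> to the left past \<open>M\<phi>\<close>, where it is
  absorbed into \<open>s\<close>.\<close>

lemma u_binomial:
  assumes "n < N"
  shows "(\<Sum>i<N. u n i * binomial_matrix x i l) = (\<Sum>i<N. s x n i * M\<phi> i l)"
proof -
  have "(\<Sum>i<N. u n i * binomial_matrix x i l)
      = (\<Sum>j<N. t n j * (\<Sum>i<N. M\<phi> j i * binomial_matrix x i l))"
    unfolding u_eq_sum[OF assms] sum_distrib_left sum_distrib_right
    by (subst sum.swap) (simp add: mult.assoc)
  also have "\<dots> = (\<Sum>j<N. t n j * (\<Sum>i<N. binomial_matrix x j i * M\<phi> i l))"
    by (simp add: scaled_toeplitz_binomial_commute)
  also have "\<dots> = (\<Sum>i<N. s x n i * M\<phi> i l)"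
    unfolding s_eq_sum[OF assms] sum_distrib_left sum_distrib_right
    by (subst sum.swap) (simp add: mult.assoc)
  finally show ?thesis .
qed

text \<open>Row \<open>i\<close> of \<open>\<Delta> My B\<^sub>x = \<Delta> B\<^sub>x My = B\<^sub>x
  (\<Delta> + x I) My\<close>. The bound \<open>Suc i < N\<close> keeps the superdiagonal entry of
  each contributing row inside the truncation.\<close>

lemma binomial_shift:
  assumes "Suc i < N"
  shows "(\<Sum>l<N. My (Suc i) l * binomial_matrix x l k)
    = (\<Sum>l<N. binomial_matrix x i l * trunc_mult N (bidiagonal x) My l k)"
proof -
  obtain N' where N: "N = Suc N'" using assms by (cases N) auto
  have "(\<Sum>l<N. My (Suc i) l * binomial_matrix x l k)
      = (\<Sum>l<N. binomial_matrix x (Suc i) l * My l k)"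
    by (rule scaled_toeplitz_binomial_commute[OF assms])
  also have "\<dots> = (\<Sum>l<N. binomial_matrix x i l * (x * My l k))
      + (\<Sum>l<N. (case l of 0 \<Rightarrow> 0 | Suc l' \<Rightarrow> binomial_matrix x i l') * My l k)"
    unfolding sum.distrib[symmetric] by (rule sum.cong) (auto simp: binomial_matrix_Suc algebra_simps)
  also have "(\<Sum>l<N. (case l of 0 \<Rightarrow> 0 | Suc l' \<Rightarrow> binomial_matrix x i l') * My l k)
      = (\<Sum>l<N'. binomial_matrix x i l * My (Suc l) k)"
    unfolding N by (subst sum.lessThan_Suc_shift) simp
  also have "\<dots> = (\<Sum>l<N. binomial_matrix x i l * My (Suc l) k)"
    using assms by (simp add: N binomial_matrix_eq_0)
  also have "(\<Sum>l<N. binomial_matrix x i l * (x * My l k)) + \<dots>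
      = (\<Sum>l<N. binomial_matrix x i l * trunc_mult N (bidiagonal x) My l k)"
    unfolding sum.distrib[symmetric]
  proof (rule sum.cong[OF refl])
    fix l
    show "binomial_matrix x i l * (x * My l k) + binomial_matrix x i l * My (Suc l) k
      = binomial_matrix x i l * trunc_mult N (bidiagonal x) My l k"
      using assms
      by (cases "Suc l < N") (auto simp: bidiagonal_mult binomial_matrix_eq_0 algebra_simps)
  qed
  finally show ?thesis .
qed

lemma s_Suc:
  assumes "Suc n < N"
  shows "s x (Suc n) k = (\<Sum>j<N. s x n j * production N x j k)"
proof -
  have "s x (Suc n) k = (\<Sum>l<N. (\<Sum>i<N. u n i * My (Suc i) l) * binomial_matrix x l k)"
  proof -
    have "(\<Sum>i\<le>n. u n i * My (Suc i) l) = (\<Sum>i<N. u n i * My (Suc i) l)" for l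
      by (rule sum.mono_neutral_left) (use assms in \<open>auto simp: u_eq_0\<close>)
    then show ?thesis
      unfolding s_eq_sum[OF assms] t_Suc_eq_u by simp
  qed
  also have "\<dots> = (\<Sum>i<N. u n i * (\<Sum>l<N. My (Suc i) l * binomial_matrix x l k))"
    unfolding sum_distrib_left sum_distrib_right by (subst sum.swap) (simp add: mult.assoc)
  also have "\<dots> = (\<Sum>i<N. u n i * (\<Sum>l<N. binomial_matrix x i l * trunc_mult N (bidiagonal x) My l k))"
  proof (rule sum.cong[OF refl])
    fix i
    show "u n i * (\<Sum>l<N. My (Suc i) l * binomial_matrix x l k)
      = u n i * (\<Sum>l<N. binomial_matrix x i l * trunc_mult N (bidiagonal x) My l k)"
      using binomial_shift[of i N x k] assms by (cases "i \<le> n") (auto simp: u_eq_0)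
  qed
  also have "\<dots> = (\<Sum>l<N. (\<Sum>i<N. u n i * binomial_matrix x i l) * trunc_mult N (bidiagonal x) My l k)"
    unfolding sum_distrib_left sum_distrib_right by (subst sum.swap) (simp add: mult.assoc)
  also have "\<dots> = (\<Sum>l<N. (\<Sum>i<N. s x n i * M\<phi> i l) * trunc_mult N (bidiagonal x) My l k)"
    using assms by (simp add: u_binomial)
  also have "\<dots> = (\<Sum>j<N. s x n j * production N x j k)"
    unfolding sum_distrib_left sum_distrib_right production_def trunc_mult_def[of N M\<phi>]
    by (subst sum.swap) (simp add: mult.assoc)
  finally show ?thesis .
qed

lemma s_eq_trunc_output: "n < N \<Longrightarrow> s x n k = trunc_output N (production N x) n k"
proof (induction n arbitrary: k)
  case 0
  show ?case by (simp add: s_def t_0 binomial_matrix_def binomial_eq_0)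
next
  case (Suc n)
  then show ?case by (simp add: s_Suc)
qed

lemma s_0_eq_t: "s 0 n k = t n k"
proof -
  have "s 0 n k = (\<Sum>j\<le>n. if j = k then t n j else 0)"
    unfolding s_def by (rule sum.cong) (auto simp: binomial_matrix_def binomial_eq_0 power_0_left)
  then show ?thesis by (auto simp: t_eq_0)
qed

lemma s_column_0: "s x n 0 = (\<Sum>j\<le>n. t n j * x ^ j)"
  by (simp add: s_def binomial_matrix_def)

context
  fixes P :: "'a set" and r :: enat
  assumes P: "partially_ordered_ring P" and y: "y \<in> P" and \<phi>: "toeplitz_totally_positive P r \<phi>"
begin

lemma totally_positive_production: "x \<in> P \<Longrightarrow> totally_positive P r (production N x)"
  unfolding production_def
  by (intro totally_positive_trunc_mult totally_positive_scaled_toeplitz totally_positive_bidiagonal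
      toeplitz_totally_positive_power P y \<phi>)

text \<open>The production matrix varies with the truncation bound, so no single one yields all of
  \<open>t\<close>. Taking the bound \<open>n\<close> is enough for the rows below
  \<open>n\<close>.\<close>

lemma totally_positive_t: "totally_positive P r t"
  unfolding totally_positive_iff_rows
proof
  fix n
  have "totally_positive_rows P r n (trunc_output n (production n 0))"
    using totally_positive_trunc_output[OF P totally_positive_production[of 0 n]] P
    by (auto simp: totally_positive_iff_rows por_basic)
  moreover have "minor t m I J = minor (trunc_output n (production n 0)) m I J"
    if "\<forall>a<m. I a < n" for m I J
    using that by (intro minor_cong) (simp flip: s_eq_trunc_output add: s_0_eq_t)
  ultimately show "totally_positive_rows P r n t"
    by (simp add: totally_positive_rows_def)
qed

lemma hankel_totally_positive_row_polynomials:
  assumes "x \<in> P"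
  shows "hankel_totally_positive P r (\<lambda>n. \<Sum>j\<le>n. t n j * x ^ j)"
  unfolding hankel_totally_positive_def totally_positive_def
proof (intro allI impI)
  fix m and I J :: "nat \<Rightarrow> nat"
  assume m: "enat m \<le> r" "strict_mono_on {..<m} I" "strict_mono_on {..<m} J"
  \<comment> \<open>A bound exceeding every index \<open>I a + J b\<close> of the minor.\<close>
  let ?N = "Suc ((\<Sum>a<m. I a) + (\<Sum>a<m. J a))"
  have "I a + J b < ?N" if "a < m" "b < m" for a b
    using that by (auto simp: less_Suc_eq_le intro!: add_mono member_le_sum)
  then have "minor (hankel_matrix (\<lambda>n. \<Sum>j\<le>n. t n j * x ^ j)) m I J
      = minor (\<lambda>i j. trunc_output ?N (production ?N x) (i + j) 0) m I J"
    by (intro minor_cong) (simp add: hankel_matrix_def flip: s_eq_trunc_output s_column_0 del: sum.lessThan_Suc)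
  also have "\<dots> \<in> P"
    using totally_positive_hankel_trunc_output[OF P totally_positive_production[OF assms], of ?N ?N] m
    by (simp add: totally_positive_def)
  finally show "minor (hankel_matrix (\<lambda>n. \<Sum>j\<le>n. t n j * x ^ j)) m I J \<in> P" .
qed

end

end

section \<open>Passage to constant polynomials\<close>

lemma toeplitz_totally_positive_const_poly:
  assumes "partially_ordered_ring P" "toeplitz_totally_positive P r \<phi>"
  shows "toeplitz_totally_positive (coeffwise P) r (\<lambda>n. [:\<phi> n:])"
  unfolding toeplitz_totally_positive_def totally_positive_def
proof (intro allI impI)
  fix m and I J :: "nat \<Rightarrow> nat"
  assume m: "enat m \<le> r" "strict_mono_on {..<m} I" "strict_mono_on {..<m} J"
  interpret comm_ring_hom "\<lambda>c :: 'a. [:c:]"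
    by unfold_locales (auto simp: one_pCons)
  have "minor (toeplitz_matrix (\<lambda>n. [:\<phi> n:])) m I J = [:minor (toeplitz_matrix \<phi>) m I J:]"
    unfolding minor_def
    by (subst hom_det[symmetric], rule arg_cong[where f = det])
      (auto intro!: eq_matI simp: toeplitz_matrix_def)
  moreover have "minor (toeplitz_matrix \<phi>) m I J \<in> P"
    using assms(2) m by (simp add: toeplitz_totally_positive_def totally_positive_def)
  ultimately show "minor (toeplitz_matrix (\<lambda>n. [:\<phi> n:])) m I J \<in> coeffwise P"
    using por_basic(1)[OF assms(1)] by (auto simp: coeffwise_def coeff_pCons split: nat.split)
qed

lemma monom_in_coeffwise:
  assumes "partially_ordered_ring P" "c \<in> P"
  shows "monom c n \<in> coeffwise P"
  using assms by (auto simp: coeffwise_def por_basic)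

section \<open>Parent functions\<close>

definition ancestor :: "(nat \<Rightarrow> nat) \<Rightarrow> nat \<Rightarrow> nat \<Rightarrow> bool" where
  "ancestor f i j \<longleftrightarrow> (\<exists>m. (f ^^ m) j = i)"

lemma ancestor_refl [simp]: "ancestor f i i"
  unfolding ancestor_def by (rule exI[of _ 0]) simp

lemma ancestor_step: "ancestor f i (f j) \<Longrightarrow> ancestor f i j"
  unfolding ancestor_def by (metis funpow_Suc_right o_apply)

lemma ancestor_unfold: "ancestor f i j \<longleftrightarrow> i = j \<or> ancestor f i (f j)"
proof
  assume "ancestor f i j"
  then obtain m where "(f ^^ m) j = i" by (auto simp: ancestor_def)
  then show "i = j \<or> ancestor f i (f j)"
    by (cases m) (auto simp: ancestor_def funpow_swap1)
qed (use ancestor_step in auto)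

lemma ancestor_linear:
  assumes "ancestor f i k" "ancestor f j k"
  shows "ancestor f i j \<or> ancestor f j i"
proof -
  obtain m n where mn: "(f ^^ m) k = i" "(f ^^ n) k = j"
    using assms by (auto simp: ancestor_def)
  show ?thesis
  proof (cases "m \<le> n")
    case True
    then have "(f ^^ (n - m)) i = j"
      using mn by (metis funpow_add le_add_diff_inverse2 o_apply)
    then show ?thesis by (auto simp: ancestor_def)
  next
    case False
    then have "(f ^^ (m - n)) j = i"
      using mn by (metis funpow_add le_add_diff_inverse2 nat_le_linear o_apply)
    then show ?thesis by (auto simp: ancestor_def)
  qed
qed

text \<open>Using 0 as a sink that every vertex reaches excludes other cycles and infinite ascents
  at once, and keeps parent functions total.\<close>

definition acyclic_fun :: "(nat \<Rightarrow> nat) \<Rightarrow> bool" where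
  "acyclic_fun f \<longleftrightarrow> f 0 = 0 \<and> (\<forall>v. ancestor f 0 v)"

lemma acyclic_fun_0: "acyclic_fun f \<Longrightarrow> f 0 = 0"
  by (simp add: acyclic_fun_def)

lemma acyclic_fun_ancestor_0: "acyclic_fun f \<Longrightarrow> ancestor f 0 v"
  by (simp add: acyclic_fun_def)

lemma ancestor_of_0:
  assumes "f 0 = 0"
  shows "ancestor f i 0 \<longleftrightarrow> i = 0"
proof -
  have "(f ^^ m) 0 = 0" for m
    by (induction m) (use assms in auto)
  then show ?thesis by (auto simp: ancestor_def)
qed

definition depth :: "(nat \<Rightarrow> nat) \<Rightarrow> nat \<Rightarrow> nat" where
  "depth f v = (LEAST m. (f ^^ m) v = 0)"

lemma depth_parent:
  assumes "acyclic_fun f" "v \<noteq> 0"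
  shows "depth f v = Suc (depth f (f v))"
proof -
  obtain m where "(f ^^ m) v = 0"
    using acyclic_fun_ancestor_0[OF assms(1)] by (auto simp: ancestor_def)
  then have "(LEAST m. (f ^^ m) v = 0) = Suc (LEAST m. (f ^^ Suc m) v = 0)"
    by (rule Least_Suc) (use assms(2) in simp)
  then show ?thesis
    by (simp add: depth_def funpow_swap1)
qed

lemma depth_ancestor_less:
  assumes "acyclic_fun f" "ancestor f i j" "i \<noteq> j"
  shows "depth f i < depth f j"
proof -
  have "(f ^^ m) j = i \<Longrightarrow> i \<noteq> j \<Longrightarrow> depth f i < depth f j" for m j
  proof (induction m arbitrary: j)
    case (Suc m)
    have "ancestor f i j"
      using Suc.prems(1) unfolding ancestor_def by blast
    then have "j \<noteq> 0"
      using Suc.prems(2) ancestor_of_0[of f i] acyclic_fun_0[OF assms(1)] by (cases "j = 0") auto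
    moreover have "i = f j \<or> depth f i < depth f (f j)"
      using Suc by (auto simp: funpow_swap1)
    ultimately show ?case
      using depth_parent[OF assms(1), of j] by auto
  qed simp
  then show ?thesis
    using assms by (auto simp: ancestor_def)
qed

lemma ancestor_antisym: "acyclic_fun f \<Longrightarrow> ancestor f i j \<Longrightarrow> ancestor f j i \<Longrightarrow> i = j"
  using depth_ancestor_less by (metis less_asym)

lemma parent_neq: "acyclic_fun f \<Longrightarrow> v \<noteq> 0 \<Longrightarrow> f v \<noteq> v"
  using depth_parent[of f v] by (metis n_not_Suc_n)

lemma not_ancestor_parent:
  assumes "acyclic_fun f" "v \<noteq> 0"
  shows "\<not> ancestor f v (f v)"
proof
  assume "ancestor f v (f v)"
  then have "depth f v < depth f (f v)"
    using depth_ancestor_less[OF assms(1)] parent_neq[OF assms] by metis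
  then show False
    using depth_parent[OF assms] by linarith
qed

text \<open>The hypothesis covers all strict ancestors, not just the parent, because swapping and
  contracting edges need it at the grandparent.\<close>

lemma acyclic_fun_induct [consumes 1]:
  assumes "acyclic_fun f" and "\<And>v. (\<And>u. ancestor f u v \<Longrightarrow> u \<noteq> v \<Longrightarrow> Q u) \<Longrightarrow> Q v"
  shows "Q v"
proof (induction v rule: measure_induct_rule[of "depth f"])
  case (less v)
  then show ?case using assms depth_ancestor_less by blast
qed

lemma acyclic_fun_strict_ancestor:
  assumes "acyclic_fun f" "v \<noteq> 0"
  shows "ancestor f (f v) v" "f v \<noteq> v"
  using assms parent_neq ancestor_step[OF ancestor_refl] by auto

lemma acyclic_fun_grandparent:
  assumes "acyclic_fun f" "v \<noteq> 0" "f v \<noteq> 0"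
  shows "ancestor f (f (f v)) v" "f (f v) \<noteq> v"
proof -
  show "ancestor f (f (f v)) v" by (rule ancestor_step[OF ancestor_step[OF ancestor_refl]])
  show "f (f v) \<noteq> v"
    using not_ancestor_parent[OF assms(1,2)] ancestor_step[of f v "f v"] by auto
qed

text \<open>The value 0 is not a vertex: it serves as the parent of the root and of all non-vertices.\<close>

definition parent_fun :: "nat set \<Rightarrow> (nat \<Rightarrow> nat) \<Rightarrow> bool" where
  "parent_fun V f \<longleftrightarrow> acyclic_fun f \<and> (\<forall>v. v \<notin> V \<longrightarrow> f v = 0) \<and> (\<forall>v. f v \<noteq> 0 \<longrightarrow> f v \<in> V) \<and>
     (\<exists>r. {v\<in>V. f v = 0} = {r})"

lemma parent_funD:
  assumes "parent_fun V f"
  shows "acyclic_fun f" "v \<notin> V \<Longrightarrow> f v = 0" "f v \<noteq> 0 \<Longrightarrow> f v \<in> V" "f v \<noteq> 0 \<Longrightarrow> v \<in> V"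
  using assms by (auto simp: parent_fun_def)

lemma finite_parent_fun:
  assumes "finite V"
  shows "finite {f. parent_fun V f}"
proof (rule finite_subset)
  show "{f. parent_fun V f} \<subseteq> {f. \<forall>v. (v \<in> V \<longrightarrow> f v \<in> insert 0 V) \<and> (v \<notin> V \<longrightarrow> f v = 0)}"
    by (auto simp: parent_fun_def)
  show "finite {f. \<forall>v. (v \<in> V \<longrightarrow> f v \<in> insert 0 V) \<and> (v \<notin> V \<longrightarrow> f v = (0::nat))}"
    using assms by (intro finite_set_of_finite_funs) auto
qed

lemma ancestor_mem:
  assumes "parent_fun V f" "ancestor f j l" "j \<in> V" "0 \<notin> V"
  shows "l \<in> V"
proof (rule ccontr)
  assume "l \<notin> V"
  then have "f l = 0" "l \<noteq> j"
    using assms by (auto simp: parent_fun_def)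
  then have "j = 0"
    using assms(2) ancestor_unfold[of f j l] ancestor_of_0[of f j] parent_funD(1)[OF assms(1)] by (auto simp: acyclic_fun_0)
  then show False using assms by simp
qed

section \<open>Improper edges, indexed by their lower endpoint, and weights\<close>

definition improper :: "(nat \<Rightarrow> nat) \<Rightarrow> nat \<Rightarrow> bool" where
  "improper f j \<longleftrightarrow> f j \<noteq> 0 \<and> (\<exists>l. ancestor f j l \<and> l < f j)"

lemma improper_in: "parent_fun V f \<Longrightarrow> improper f j \<Longrightarrow> j \<in> V"
  by (auto simp: improper_def intro: parent_funD(4))

lemma finite_improper: "finite V \<Longrightarrow> parent_fun V f \<Longrightarrow> finite {j. improper f j}"
  by (rule finite_subset[of _ V]) (auto intro: improper_in)

text \<open>Descendants of a vertex are vertices, and none of them is below the minimum. This is why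
  edges out of the smallest vertex cost nothing.\<close>

lemma not_improper_min:
  assumes "parent_fun V f" "0 \<notin> V" "\<And>v. v \<in> V \<Longrightarrow> a \<le> v" "f j = a"
  shows "\<not> improper f j"
proof
  assume "improper f j"
  then obtain l where "ancestor f j l" "l < a" "j \<in> V"
    using assms improper_in by (auto simp: improper_def)
  then show False
    using ancestor_mem[OF assms(1) _ _ assms(2)] assms(3)[of l] by auto
qed

definition proper_children :: "(nat \<Rightarrow> nat) \<Rightarrow> nat \<Rightarrow> nat set" where
  "proper_children f i = {j. f j = i \<and> \<not> improper f j}"

definition children :: "(nat \<Rightarrow> nat) \<Rightarrow> nat \<Rightarrow> nat set" where
  "children f i = {j. f j = i}"

lemma finite_children: "finite V \<Longrightarrow> parent_fun V f \<Longrightarrow> i \<noteq> 0 \<Longrightarrow> finite (children f i)"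
  by (rule finite_subset[of _ V]) (auto simp: children_def intro: parent_funD(4))

text \<open>The vertex \<open>a\<close> is omitted from the product as vertex 1 is in
  \<open>t_poly\<close>; it will always be the minimum of \<open>V\<close>.\<close>

definition weight :: "(nat \<Rightarrow> 'a::comm_ring_1) \<Rightarrow> nat set \<Rightarrow> nat \<Rightarrow> (nat \<Rightarrow> nat) \<Rightarrow> 'a poly" where
  "weight \<phi> V a f = monom (\<Prod>i\<in>V - {a}. phi_hat \<phi> (card (proper_children f i))) (card {j. improper f j})"

section \<open>Inserting one child of the minimum above another\<close>

context
  fixes f g :: "nat \<Rightarrow> nat" and a d e :: nat
  assumes a: "a \<noteq> 0" and fe: "f e = a" and fd: "f d = a" and de: "d \<noteq> e" and g: "g = f(e := d)"
begin

lemma insert_above_neq: "acyclic_fun f \<Longrightarrow> e \<noteq> 0 \<and> d \<noteq> 0 \<and> e \<noteq> a \<and> d \<noteq> a"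
  using fe fd a acyclic_fun_0[of f] parent_neq[of f] by metis

lemma acyclic_fun_insert_above:
  assumes f: "acyclic_fun f"
  shows "acyclic_fun g"
  unfolding acyclic_fun_def
proof
  have g0: "g 0 = 0" using f g insert_above_neq[OF f] by (simp add: acyclic_fun_0)
  show "g 0 = 0" by fact
  show "\<forall>v. ancestor g 0 v"
  proof
    fix v show "ancestor g 0 v"
      using f
    proof (induction v rule: acyclic_fun_induct)
      case (1 v)
      show ?case
      proof (cases "v = 0")
        case False
        have IH: "ancestor g 0 (f v)"
          using 1 acyclic_fun_strict_ancestor[OF f False] by blast
        have "ancestor g 0 d" if "v = e"
          using IH that fe fd de by (subst ancestor_unfold) (simp add: g)
        then have "ancestor g 0 (g v)"
          using IH by (cases "v = e") (auto simp: g)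
        then show ?thesis by (rule ancestor_step)
      qed simp
    qed
  qed
qed

text \<open>The converse is needed because the inverse surgery starts from \<open>g\<close> and has
  to produce a tree \<open>f\<close>.\<close>

lemma acyclic_fun_insert_above_iff:
  assumes "e \<noteq> 0"
  shows "acyclic_fun f \<longleftrightarrow> acyclic_fun g"
proof
  assume acg: "acyclic_fun g"
  show "acyclic_fun f"
    unfolding acyclic_fun_def
  proof
    show "f 0 = 0" using acg assms g acyclic_fun_0[OF acg] by simp
    show "\<forall>v. ancestor f 0 v"
    proof
      fix v show "ancestor f 0 v"
        using acg
      proof (induction v rule: acyclic_fun_induct)
        case (1 v)
        show ?case
        proof (cases "v = 0")
          case False
          have IH: "ancestor f 0 (g v)"
            using 1 acyclic_fun_strict_ancestor[OF acg False] by blast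
          have "ancestor f 0 a" if "v = e"
          proof -
            have "g d = a" by (simp add: g de fd)
            then have "d \<noteq> 0" using a acyclic_fun_0[OF acg] by metis
            then show ?thesis
              using IH that ancestor_unfold[of f 0 d] by (simp add: g fd)
          qed
          then have "ancestor f 0 (f v)"
            using IH by (cases "v = e") (auto simp: g fe)
          then show ?thesis by (rule ancestor_step)
        qed simp
      qed
    qed
  qed
qed (rule acyclic_fun_insert_above)

text \<open>The subtree of \<open>e\<close> stays below \<open>a\<close> and all ancestors of
  \<open>a\<close>; the one change is that \<open>d\<close> now lies above it as well.\<close>

lemma ancestor_insert_above:
  assumes f: "acyclic_fun f"
  shows "ancestor g i j \<longleftrightarrow> ancestor f i j \<or> (i = d \<and> ancestor f e j)"
  using acyclic_fun_insert_above[OF f]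
proof (induction j rule: acyclic_fun_induct)
  case (1 j)
  note nz = insert_above_neq[OF f]
  note acg = acyclic_fun_insert_above[OF f]
  have e_par: "\<not> ancestor f e a" using not_ancestor_parent[OF f, of e] fe nz by auto
  show ?case
  proof (cases "j = 0")
    case True
    then show ?thesis
      using nz f acg by (auto simp: ancestor_of_0 acyclic_fun_0)
  next
    case False
    then have IH: "ancestor g i (g j) \<longleftrightarrow> ancestor f i (g j) \<or> (i = d \<and> ancestor f e (g j))"
      using 1 acyclic_fun_strict_ancestor[OF acg False] by blast
    show ?thesis
    proof (cases "j = e")
      case True
      have "g j = d" using True by (simp add: g)
      moreover have "ancestor f i d \<longleftrightarrow> i = d \<or> ancestor f i a" "\<not> ancestor f e d" "ancestor f i j \<longleftrightarrow> i = e \<or> ancestor f i a"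
        using ancestor_unfold[of f i d] ancestor_unfold[of f e d] ancestor_unfold[of f i e] fd fe e_par de True by metis+
      ultimately show ?thesis
        using IH ancestor_unfold[of g i j] True ancestor_refl by metis
    next
      case False
      then have "g j = f j" by (simp add: g)
      then show ?thesis
        using False IH ancestor_unfold[of g i j] ancestor_unfold[of f i j] ancestor_unfold[of f e j] nz by metis
    qed
  qed
qed

lemma children_insert_above: "acyclic_fun f \<Longrightarrow> children g a = children f a - {e}"
  using fe de insert_above_neq g a fd by (auto simp: children_def)

lemma parent_fun_insert_above:
  assumes "e \<in> V" "d \<in> V" "0 \<notin> V"
  shows "parent_fun V f \<longleftrightarrow> parent_fun V g"
proof -
  have "acyclic_fun f \<longleftrightarrow> acyclic_fun g" by (rule acyclic_fun_insert_above_iff) (use assms in metis)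
  moreover have "{v\<in>V. g v = 0} = {v\<in>V. f v = 0}"
  proof -
    have "d \<noteq> 0" using assms by metis
    then show ?thesis using a fe by (auto simp: g)
  qed
  moreover have "(\<forall>v. v \<notin> V \<longrightarrow> g v = 0) \<longleftrightarrow> (\<forall>v. v \<notin> V \<longrightarrow> f v = 0)"
    using assms by (auto simp: g)
  moreover have "(\<forall>v. g v \<noteq> 0 \<longrightarrow> g v \<in> V) \<longleftrightarrow> (\<forall>v. f v \<noteq> 0 \<longrightarrow> f v \<in> V)"
  proof
    assume *: "\<forall>v. g v \<noteq> 0 \<longrightarrow> g v \<in> V"
    show "\<forall>v. f v \<noteq> 0 \<longrightarrow> f v \<in> V"
    proof (intro allI impI)
      fix v assume "f v \<noteq> 0"
      moreover have "a \<in> V" using *[rule_format, of d] a fd de by (simp add: g)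
      ultimately show "f v \<in> V"
        using *[rule_format, of v] fe by (cases "v = e") (auto simp: g)
    qed
  qed (use assms in \<open>auto simp: g\<close>)
  ultimately show ?thesis
    by (simp add: parent_fun_def)
qed

text \<open>As \<open>d\<close> is not above \<open>b\<close>, it differs from \<open>b\<close> and
  hence exceeds it. Since \<open>b\<close> lies below \<open>e\<close>, the new edge from
  \<open>d\<close> to \<open>e\<close> is improper, whereas the old edge from \<open>a\<close> to
  \<open>e\<close> was proper. The proper degree of \<open>d\<close> does not notice its new
  child.\<close>

lemma weight_insert_above:
  assumes f: "parent_fun V f" and V: "finite V" "0 \<notin> V" and amin: "\<And>v. v \<in> V \<Longrightarrow> a \<le> v"
    and b: "b \<in> V" "b \<noteq> a" "\<And>v. v \<in> V \<Longrightarrow> v \<noteq> a \<Longrightarrow> b \<le> v"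
    and ancestor: "ancestor f e b" "\<not> ancestor f d b"
  shows "weight \<phi> V a g = monom 1 1 * weight \<phi> V a f"
proof -
  note acf = parent_funD(1)[OF f]
  have dV: "d \<in> V" and eV: "e \<in> V"
    using parent_funD(4)[OF f] fd fe a by auto
  have pg: "parent_fun V g" using f parent_fun_insert_above[OF eV dV V(2)] by simp
  have "b < d"
    using b(3)[OF dV] ancestor(2) insert_above_neq[OF acf] by (cases "b = d") auto
  moreover have "ancestor g e b" "g e = d" "d \<noteq> 0"
    using ancestor(1) insert_above_neq[OF acf] by (simp_all add: ancestor_insert_above[OF acf]) (simp add: g)
  ultimately have e: "improper g e"
    by (auto simp: improper_def)
  have e': "\<not> improper f e"
    by (rule not_improper_min[OF f V(2) amin fe])
  have imp: "improper g j \<longleftrightarrow> improper f j \<or> j = e" for j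
  proof (cases "j = e \<or> j = d")
    case True
    have "\<not> improper g d" "\<not> improper f d"
      by (rule not_improper_min[OF _ V(2) amin], use pg f fd de in \<open>simp_all add: g\<close>)+
    then show ?thesis using True e e' de by auto
  next
    case False
    then show ?thesis
      by (simp add: improper_def g ancestor_insert_above[OF acf, unfolded g])
  qed
  then have "{j. improper g j} = insert e {j. improper f j}"
    by auto
  then have "card {j. improper g j} = Suc (card {j. improper f j})"
    using e' finite_improper[OF V(1) f] by simp
  moreover have "proper_children g i = proper_children f i" if "i \<in> V - {a}" for i
  proof (rule Set.set_eqI)
    fix j
    show "j \<in> proper_children g i \<longleftrightarrow> j \<in> proper_children f i"
      using that e fe imp[of j] by (cases "j = e") (auto simp: proper_children_def g)
  qed
  ultimately show ?thesis
    by (simp add: weight_def mult_monom)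
qed

end

section \<open>Swapping the minimum with one of its children\<close>

context
  fixes f g :: "nat \<Rightarrow> nat" and a c :: nat
  assumes a: "a \<noteq> 0" and fc: "f c = a" and ca: "c \<noteq> a" and g: "g = f(c := f a, a := c)"
begin

lemma acyclic_fun_swap:
  assumes f: "acyclic_fun f"
  shows "acyclic_fun g"
  unfolding acyclic_fun_def
proof
  have c0: "c \<noteq> 0" using f fc a acyclic_fun_0 by metis
  show "g 0 = 0" using f c0 a by (simp add: g acyclic_fun_0)
  show "\<forall>v. ancestor g 0 v"
  proof
    fix v show "ancestor g 0 v"
      using f
    proof (induction v rule: acyclic_fun_induct)
      case (1 v)
      have fa: "f a \<noteq> c" using acyclic_fun_grandparent(2)[OF f c0] fc a by auto
      have c: "ancestor g 0 c" if "ancestor g 0 (f a)"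
        using that by (intro ancestor_step[of g 0 c]) (simp add: g ca)
      show ?case
      proof (cases "v = 0")
        case False
        have IH: "ancestor g 0 (f v)"
          using 1 acyclic_fun_strict_ancestor[OF f False] by blast
        show ?thesis
        proof (cases "v = c")
          case True
          then have "ancestor f (f a) v" "f a \<noteq> v"
            using acyclic_fun_grandparent[OF f c0] fc a by auto
          then show ?thesis using c 1 True by blast
        next
          case vc: False
          show ?thesis
          proof (cases "v = a")
            case True
            then show ?thesis using IH c by (intro ancestor_step[of g 0 v]) (simp add: g)
          next
            case False
            then show ?thesis using IH vc by (intro ancestor_step[of g 0 v]) (simp add: g)
          qed
        qed
      qed simp
    qed
  qed
qed

lemma acyclic_fun_unswap:
  assumes acg: "acyclic_fun g" and c0: "c \<noteq> 0"
  shows "acyclic_fun f"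
  unfolding acyclic_fun_def
proof
  show "f 0 = 0" using acyclic_fun_0[OF acg] c0 a by (simp add: g)
  show "\<forall>v. ancestor f 0 v"
  proof
    fix v show "ancestor f 0 v"
      using acg
    proof (induction v rule: acyclic_fun_induct)
      case (1 v)
      have gc: "g c = f a" and ga: "g a = c" using ca by (auto simp: g)
      have *: "ancestor f 0 c" "ancestor f 0 a" if "ancestor f 0 (f a)"
        using that ancestor_step[of f 0 a] ancestor_step[of f 0 c] fc by auto
      show ?case
      proof (cases "v = 0")
        case False
        have IH: "ancestor f 0 (g v)"
          using 1 acyclic_fun_strict_ancestor[OF acg False] by blast
        show ?thesis
        proof (cases "v = a")
          case True
          have "ancestor g (f a) v" "f a \<noteq> v"
            using acyclic_fun_grandparent[OF acg a] ga gc c0 True by auto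
          then show ?thesis using * 1 True by blast
        next
          case va: False
          show ?thesis
          proof (cases "v = c")
            case True
            then show ?thesis using IH * gc by simp
          next
            case False
            then show ?thesis using IH va by (intro ancestor_step[of f 0 v]) (simp add: g)
          qed
        qed
      qed simp
    qed
  qed
qed

text \<open>The vertex \<open>c\<close> takes over everything that was below \<open>a\<close>, while
  \<open>a\<close> loses the former subtree of \<open>c\<close>. All other vertices keep their
  descendants.\<close>

lemma ancestor_swap:
  assumes f: "acyclic_fun f"
  shows "ancestor g i j \<longleftrightarrow>
    (if i = a then ancestor f a j \<and> \<not> ancestor f c j else if i = c then ancestor f a j else ancestor f i j)"
  using acyclic_fun_swap[OF f]
proof (induction j rule: acyclic_fun_induct)
  case (1 j)
  note acg = acyclic_fun_swap[OF f]
  have c0: "c \<noteq> 0" using f fc a acyclic_fun_0 by metis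
  have gc: "g c = f a" and ga: "g a = c" using ca by (auto simp: g)
  have na: "\<not> ancestor f a (f a)" "\<not> ancestor f c a" "\<not> ancestor f c (f a)"
    using not_ancestor_parent[OF f a] not_ancestor_parent[OF f c0] fc ancestor_step[of f c a] by auto
  have cj: "ancestor f i c \<longleftrightarrow> i = c \<or> i = a \<or> ancestor f i (f a)" and aj: "ancestor f i a \<longleftrightarrow> i = a \<or> ancestor f i (f a)" for i
    using ancestor_unfold[of f i c] ancestor_unfold[of f i a] fc by auto
  show ?case
  proof (cases "j = 0")
    case True
    then show ?thesis
      using a c0 f acg by (auto simp: ancestor_of_0 acyclic_fun_0)
  next
    case False
    note IH = 1[OF acyclic_fun_strict_ancestor[OF acg False]]
    consider "j = a" | "j = c" | "j \<noteq> a" "j \<noteq> c" by blast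
    then show ?thesis
    proof cases
      case 1
      then show ?thesis
        using IH ancestor_unfold[of g i j] na by (auto simp: ga cj aj ca)
    next
      case 2
      then show ?thesis
        using IH ancestor_unfold[of g i j] na ca by (auto simp: gc cj aj)
    next
      case 3
      then have "g j = f j" by (simp add: g)
      then show ?thesis
        using IH 3 ancestor_unfold[of g i j] ancestor_unfold[of f i j] ancestor_unfold[of f a j] ancestor_unfold[of f c j]
        by auto
    qed
  qed
qed

lemma children_swap: "acyclic_fun f \<Longrightarrow> children g a = children f a - {c}"
  using fc ca parent_neq[of f a] a by (auto simp: children_def g)

lemma parent_fun_swap:
  assumes "c \<in> V" "a \<in> V" "0 \<notin> V"
  shows "parent_fun V f \<longleftrightarrow> parent_fun V g"
proof -
  have c0: "c \<noteq> 0" using assms by metis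
  have "acyclic_fun f \<longleftrightarrow> acyclic_fun g" using acyclic_fun_swap acyclic_fun_unswap c0 by metis
  moreover have "(\<exists>r. {v\<in>V. g v = 0} = {r}) \<longleftrightarrow> (\<exists>r. {v\<in>V. f v = 0} = {r})"
  proof (cases "f a = 0")
    case True
    \<comment> \<open>If \<open>a\<close> was the root, the swap makes \<open>c\<close> the root;
      uniqueness of the root is carried over by exchanging the two.\<close>
    have "bij_betw (transpose a c) {v\<in>V. f v = 0} {v\<in>V. g v = 0}"
    proof (rule bij_betw_byWitness[where f' = "transpose a c"])
    qed (use assms a fc ca c0 True in \<open>auto simp: g transpose_def\<close>)
    then have "card {v\<in>V. f v = 0} = card {v\<in>V. g v = 0}"
      by (rule bij_betw_same_card)
    then show ?thesis by (metis (no_types) is_singleton_altdef is_singleton_def)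
  next
    case False
    then have "{v\<in>V. g v = 0} = {v\<in>V. f v = 0}"
      using c0 a fc by (auto simp: g)
    then show ?thesis by simp
  qed
  moreover have "(\<forall>v. v \<notin> V \<longrightarrow> g v = 0) \<longleftrightarrow> (\<forall>v. v \<notin> V \<longrightarrow> f v = 0)"
    using assms by (auto simp: g)
  moreover have "(\<forall>v. g v \<noteq> 0 \<longrightarrow> g v \<in> V) \<longleftrightarrow> (\<forall>v. f v \<noteq> 0 \<longrightarrow> f v \<in> V)"
  proof
    assume *: "\<forall>v. g v \<noteq> 0 \<longrightarrow> g v \<in> V"
    show "\<forall>v. f v \<noteq> 0 \<longrightarrow> f v \<in> V"
    proof (intro allI impI)
      fix v assume "f v \<noteq> 0"
      then show "f v \<in> V"
        using *[rule_format, of v] *[rule_format, of c] assms fc ca by (cases "v = c"; cases "v = a") (auto simp: g)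
    qed
  qed (use assms in \<open>auto simp: g\<close>)
  ultimately show ?thesis
    by (simp add: parent_fun_def)
qed

text \<open>The edge from \<open>c\<close> down to \<open>a\<close> is improper because of
  \<open>a\<close> itself, while the old edge from \<open>a\<close> to \<open>c\<close> was proper.
  An edge from the former parent of \<open>a\<close> stays improper with \<open>c\<close> as its
  lower end, since \<open>a\<close> is still below it. So exactly one improper edge is gained, and
  proper degrees away from \<open>a\<close> are unchanged.\<close>

lemma weight_swap:
  assumes f: "parent_fun V f" and V: "finite V" "0 \<notin> V" and aV: "a \<in> V" and amin: "\<And>v. v \<in> V \<Longrightarrow> a \<le> v"
  shows "weight \<phi> V a g = monom 1 1 * weight \<phi> V a f"
proof -
  note acf = parent_funD(1)[OF f]
  have cV: "c \<in> V"
    using parent_funD(4)[OF f] fc a by auto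
  have pg: "parent_fun V g" using f parent_fun_swap[OF cV aV V(2)] by simp
  have c0: "c \<noteq> 0" using cV V(2) by metis
  have gc: "g c = f a" and ga: "g a = c" using ca by (auto simp: g)
  have less: "a < f a" if "f a \<noteq> 0"
    using amin[OF parent_funD(3)[OF f that]] parent_neq[OF acf a] by linarith
  have "improper g a"
    using amin[OF cV] ca c0 by (auto simp: improper_def ga intro!: exI[of _ a])
  moreover have "improper g c \<longleftrightarrow> f a \<noteq> 0"
    using less ca by (auto simp: improper_def gc ancestor_swap[OF acf] intro!: exI[of _ a])
  moreover have "improper g j \<longleftrightarrow> improper f j" if "j \<noteq> a" "j \<noteq> c" for j
    using that by (simp add: improper_def ancestor_swap[OF acf]) (simp add: g)
  ultimately have imp: "improper g j \<longleftrightarrow> (if j = a then True else if j = c then f a \<noteq> 0 else improper f j)" for j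
    by auto
  have fa: "improper f a \<longleftrightarrow> f a \<noteq> 0"
    using less by (auto simp: improper_def intro!: exI[of _ a])
  have nfc: "\<not> improper f c"
    by (rule not_improper_min[OF f V(2) amin fc])
  \<comment> \<open>If \<open>a\<close> was not the root, it already indexed an improper edge, so
    the additional index is \<open>c\<close>; if it was the root, the additional index is
    \<open>a\<close>.\<close>
  have "{j. improper g j} = (if f a = 0 then insert a {j. improper f j} else insert c {j. improper f j})"
    using nfc fa by (auto simp: imp)
  then have "card {j. improper g j} = Suc (card {j. improper f j})"
    using nfc fa finite_improper[OF V(1) f] by auto
  moreover have "proper_children g i = proper_children f i" if "i \<in> V - {a}" for i
  proof (rule Set.set_eqI)
    fix j
    have "i \<noteq> 0" "i \<noteq> a" using that V(2) by (metis DiffD1, simp)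
    then show "j \<in> proper_children g i \<longleftrightarrow> j \<in> proper_children f i"
      using imp[of j] fa fc gc by (cases "j = a"; cases "j = c") (auto simp: proper_children_def g)
  qed
  ultimately show ?thesis
    by (simp add: weight_def mult_monom)
qed

end

section \<open>Contracting the edge between the two smallest vertices\<close>

text \<open>The merged vertex keeps the name \<open>b\<close>, which is the minimum of the remaining
  labels; \<open>a\<close> becomes a non-vertex.\<close>

definition contract :: "nat \<Rightarrow> nat \<Rightarrow> (nat \<Rightarrow> nat) \<Rightarrow> nat \<Rightarrow> nat" where
  "contract a b f v = (if v = a then 0 else if v = b then f a else if f v = a then b else f v)"

text \<open>Inverse of the contraction: \<open>S\<close> is the set of children of the merged vertex
  that are given back to \<open>a\<close>.\<close>

definition expand :: "nat \<Rightarrow> nat \<Rightarrow> (nat \<Rightarrow> nat) \<Rightarrow> nat set \<Rightarrow> nat \<Rightarrow> nat" where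
  "expand a b g S v = (if v = a then g b else if v = b then a else if v \<in> S then a else g v)"

context
  fixes f g :: "nat \<Rightarrow> nat" and a b :: nat
  assumes a: "a \<noteq> 0" and b0: "b \<noteq> 0" and ba: "b \<noteq> a" and fb: "f b = a" and g: "g = contract a b f"
begin

lemma contract_simps: "g a = 0" "g b = f a" "v \<noteq> a \<Longrightarrow> v \<noteq> b \<Longrightarrow> f v = a \<Longrightarrow> g v = b"
  "v \<noteq> a \<Longrightarrow> v \<noteq> b \<Longrightarrow> f v \<noteq> a \<Longrightarrow> g v = f v"
  using ba by (simp_all add: g contract_def)

lemma acyclic_fun_contract:
  assumes f: "acyclic_fun f"
  shows "acyclic_fun g"
  unfolding acyclic_fun_def
proof
  show "g 0 = 0" using acyclic_fun_0[OF f] a b0 by (simp add: g contract_def)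
  show "\<forall>v. ancestor g 0 v"
  proof
    fix v show "ancestor g 0 v"
      using f
    proof (induction v rule: acyclic_fun_induct)
      case (1 v)
      show ?case
      proof (cases "v = 0 \<or> v = a")
        case True
        then show ?thesis using ancestor_step[of g 0 v] contract_simps(1) by auto
      next
        case False
        then have v0: "v \<noteq> 0" "v \<noteq> a" by auto
        show ?thesis
        proof (cases "f v = a")
          case True
          then have "ancestor f (f a) v" "f a \<noteq> v"
            using acyclic_fun_grandparent[OF f v0(1)] a by auto
          then have "ancestor g 0 (f a)" using 1 by blast
          then have "ancestor g 0 b" using ancestor_step[of g 0 b] contract_simps by simp
          then show ?thesis
            using ancestor_step[of g 0 v] contract_simps(3)[of v] v0 True by (cases "v = b") auto
        next
          case fv: False
          have "ancestor g 0 (f v)"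
            using 1 acyclic_fun_strict_ancestor[OF f v0(1)] by blast
          then show ?thesis
            using ancestor_step[of g 0 v] contract_simps(4)[of v] v0 fv fb by (cases "v = b") auto
        qed
      qed
    qed
  qed
qed

lemma ancestor_contract:
  assumes f: "acyclic_fun f"
  shows "j \<noteq> a \<Longrightarrow> ancestor g i j \<longleftrightarrow> (if i = a then False else if i = b then ancestor f a j else ancestor f i j)"
  using acyclic_fun_contract[OF f]
proof (induction j rule: acyclic_fun_induct)
  case (1 j)
  note acg = acyclic_fun_contract[OF f]
  have fa: "f a \<noteq> a" "\<not> ancestor f a (f a)" using parent_neq[OF f a] not_ancestor_parent[OF f a] by auto
  have ib: "ancestor f i b \<longleftrightarrow> i = b \<or> i = a \<or> ancestor f i (f a)" for i
    using ancestor_unfold[of f i b] ancestor_unfold[of f i a] fb by auto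
  have ia: "ancestor f i a \<longleftrightarrow> i = a \<or> ancestor f i (f a)" for i
    using ancestor_unfold[of f i a] by auto
  show ?case
  proof (cases "j = 0")
    case True
    then show ?thesis
      using a b0 f acg by (auto simp: ancestor_of_0 acyclic_fun_0)
  next
    case j0: False
    have IH: "ancestor g i (g j) \<longleftrightarrow> (if i = a then False else if i = b then ancestor f a (g j) else ancestor f i (g j))"
      if "g j \<noteq> a"
      using 1(1)[OF acyclic_fun_strict_ancestor[OF acg j0] that] .
    consider "j = b" | "j \<noteq> b" "f j = a" | "j \<noteq> b" "f j \<noteq> a" by blast
    then show ?thesis
    proof cases
      case 1
      then have "ancestor g i (f a) \<longleftrightarrow> (if i = a then False else if i = b then False else ancestor f i (f a))"
        using IH fa by (simp add: contract_simps)
      moreover have "ancestor g i j \<longleftrightarrow> i = b \<or> ancestor g i (f a)"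
        using ancestor_unfold[of g i j] 1 contract_simps(2) by simp
      ultimately show ?thesis
        using 1 ba by (auto simp: ib)
    next
      case 2
      then have "g j = b" using contract_simps(3) \<open>j \<noteq> a\<close> by simp
      then have "ancestor g i b \<longleftrightarrow> (if i = a then False else if i = b then True else ancestor f i b)"
        using IH ba by (simp add: ib)
      moreover have "ancestor g i j \<longleftrightarrow> i = j \<or> ancestor g i b"
        using ancestor_unfold[of g i j] \<open>g j = b\<close> by simp
      moreover have "ancestor f i j \<longleftrightarrow> i = j \<or> ancestor f i a" for i
        using ancestor_unfold[of f i j] 2 by simp
      ultimately show ?thesis
        using 2 ba \<open>j \<noteq> a\<close> by (auto simp: ib ia)
    next
      case 3
      then have gj: "g j = f j" using contract_simps(4) \<open>j \<noteq> a\<close> by simp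
      moreover have "ancestor g i (f j) \<longleftrightarrow> (if i = a then False else if i = b then ancestor f a (f j) else ancestor f i (f j))"
        using IH 3 gj by simp
      moreover have "ancestor f a j \<longleftrightarrow> ancestor f a (f j)"
        using ancestor_unfold[of f a j] \<open>j \<noteq> a\<close> by simp
      ultimately show ?thesis
        using 3 ancestor_unfold[of g i j] ancestor_unfold[of f i j] \<open>j \<noteq> a\<close> by simp
    qed
  qed
qed

lemma parent_fun_contract:
  assumes f: "parent_fun V f" and V: "0 \<notin> V"
  shows "parent_fun (V - {a}) g"
proof -
  note acf = parent_funD(1)[OF f]
  have aV: "a \<in> V" and bV: "b \<in> V"
    using parent_funD(3,4)[OF f] fb a by auto
  have fa: "f a \<noteq> a" by (rule parent_neq[OF acf a])
  have "g v = 0" if "v \<notin> V - {a}" for v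
  proof (cases "v = a")
    case False
    then have "f v = 0" "v \<noteq> b" using that parent_funD(2)[OF f, of v] bV by auto
    then show ?thesis using a False contract_simps(4) by simp
  qed (simp add: contract_simps)
  moreover have "g v \<in> V - {a}" if "g v \<noteq> 0" for v
    using that parent_funD(3)[OF f, of a] parent_funD(3)[OF f, of v] fa bV ba
    by (auto simp: g contract_def split: if_splits)
  moreover have "\<exists>r. {v \<in> V - {a}. g v = 0} = {r}"
  proof -
    obtain r where r: "{v\<in>V. f v = 0} = {r}"
      using f by (auto simp: parent_fun_def)
    show ?thesis
    proof (cases "f a = 0")
      case True
      then have "a \<in> {r}" unfolding r[symmetric] using aV by simp
      have root: "v = a" if "v \<in> V" "f v = 0" for v
      proof -
        have "v \<in> {r}" unfolding r[symmetric] using that by simp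
        then show ?thesis using \<open>a \<in> {r}\<close> by simp
      qed
      have "{v \<in> V - {a}. g v = 0} = {b}"
        using True bV ba b0 by (auto simp: g contract_def dest: root split: if_splits)
      then show ?thesis by blast
    next
      case False
      have "v \<in> V - {a} \<and> g v = 0 \<longleftrightarrow> v \<in> V \<and> f v = 0" for v
        using False b0 a fb contract_simps(1,2) contract_simps(3,4)[of v]
        by (cases "v = a"; cases "v = b"; cases "f v = a") simp_all
      then show ?thesis using r by simp
    qed
  qed
  ultimately show ?thesis
    using acyclic_fun_contract[OF acf] by (auto simp: parent_fun_def)
qed

lemma children_contract: "acyclic_fun f \<Longrightarrow> children g b = (children f a - {b}) \<union> children f b"
  using parent_neq[of f a] acyclic_fun_grandparent(2)[of f b] a b0 ba fb
  by (auto simp: children_def g contract_def)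

lemma expand_contract:
  assumes "acyclic_fun f"
  shows "expand a b g (children f a - {b}) = f"
proof
  fix v
  show "expand a b g (children f a - {b}) v = f v"
    using fb by (simp add: expand_def children_def g contract_def ba)
qed

text \<open>The number of improper edges is preserved: edges below \<open>a\<close> and below
  \<open>b\<close> are proper before and after, and an improper edge above \<open>a\<close> becomes
  one above \<open>b\<close>. Thus the proper degree of \<open>b\<close> in \<open>f\<close> is its
  full number of children. That factor is separated off because \<open>b\<close>, now minimal, is
  omitted from the weight of \<open>g\<close>.\<close>

lemma weight_contract:
  assumes f: "parent_fun V f" and V: "finite V" "0 \<notin> V" and amin: "\<And>v. v \<in> V \<Longrightarrow> a \<le> v"
    and bmin: "\<And>v. v \<in> V \<Longrightarrow> v \<noteq> a \<Longrightarrow> b \<le> v"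
  shows "weight \<phi> V a f = [:phi_hat \<phi> (card (children g b) - card (children f a - {b})):] * weight \<phi> (V - {a}) b g"
proof -
  note acf = parent_funD(1)[OF f]
  note pg = parent_fun_contract[OF f V(2)]
  have aV: "a \<in> V" and bV: "b \<in> V"
    using parent_funD(3,4)[OF f] fb a by auto
  have less: "b < f a" "a < f a" if "f a \<noteq> 0"
  proof -
    have "f a \<in> V" "f a \<noteq> a" "f a \<noteq> b"
      using that parent_funD(3)[OF f] parent_neq[OF acf a] acyclic_fun_grandparent(2)[OF acf b0] fb a by auto
    then show "b < f a" "a < f a" using amin[of "f a"] bmin[of "f a"] by auto
  qed
  have imp: "improper g j \<longleftrightarrow> (if j = a then False else if j = b then f a \<noteq> 0 else improper f j)" for j
  proof -
    consider "j = a" | "j = b" | "j \<noteq> a" "j \<noteq> b" "f j = a" | "j \<noteq> a" "j \<noteq> b" "f j \<noteq> a" by blast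
    then show ?thesis
    proof cases
      case 1
      then show ?thesis by (simp add: improper_def contract_simps)
    next
      case 2
      then show ?thesis using less ba by (auto simp: improper_def contract_simps intro!: exI[of _ b])
    next
      case 3
      have "\<not> improper f j" by (rule not_improper_min[OF f V(2) amin 3(3)])
      moreover have "\<not> improper g j"
        by (rule not_improper_min[OF pg _ _ contract_simps(3)[OF 3]]) (use V bmin in auto)
      ultimately show ?thesis using 3 by simp
    next
      case 4
      then have gj: "g j = f j" by (simp add: contract_simps)
      have *: "ancestor g j l \<longleftrightarrow> ancestor f j l" if "l \<noteq> a" for l
        using ancestor_contract[OF acf that] 4 by simp
      have "improper g j \<longleftrightarrow> improper f j"
      proof
        assume "improper g j"
        then obtain l where l: "ancestor g j l" "l < f j" "f j \<noteq> 0"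
          by (auto simp: improper_def gj)
        have "l \<noteq> a"
        proof
          assume "l = a"
          then have "j = 0"
            using l(1) 4 ancestor_unfold[of g j a] ancestor_of_0[of g j] acyclic_fun_0[OF parent_funD(1)[OF pg]]
            by (auto simp: contract_simps)
          then show False using l(3) acyclic_fun_0[OF acf] by simp
        qed
        then show "improper f j"
          using l * by (auto simp: improper_def)
      next
        assume "improper f j"
        then obtain l where l: "ancestor f j l" "l < f j" "f j \<noteq> 0"
          by (auto simp: improper_def)
        show "improper g j"
        proof (cases "l = a")
          case True
          \<comment> \<open>The witness \<open>a\<close> disappears in the contraction, so
            \<open>b\<close> replaces it. It is still smaller than \<open>f j\<close>, since
            \<open>f j = b\<close> would place \<open>j\<close> below \<open>a\<close>.\<close>
          then have "ancestor f j b" using l(1) ancestor_unfold[of f j b] fb by simp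
          then have "ancestor g j b" using *[OF ba] by simp
          moreover have "b < f j"
          proof -
            have "f j \<noteq> b"
            proof
              assume "f j = b"
              then have "ancestor f a j"
                using fb ancestor_step[OF ancestor_step[OF ancestor_refl], of f j] by simp
              then show False using ancestor_antisym[OF acf] l(1) True 4(1) by blast
            qed
            then show ?thesis using bmin[OF parent_funD(3)[OF f l(3)]] 4(3) by linarith
          qed
          ultimately show ?thesis using l by (auto simp: improper_def gj)
        next
          case False
          then show ?thesis using l * by (auto simp: improper_def gj)
        qed
      qed
      then show ?thesis using 4 by simp
    qed
  qed
  have fa: "improper f a \<longleftrightarrow> f a \<noteq> 0"
    using less by (auto simp: improper_def intro!: exI[of _ a])
  have nfb: "\<not> improper f b"
    by (rule not_improper_min[OF f V(2) amin fb])
  have "card {j. improper g j} = card {j. improper f j}"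
  proof (cases "f a = 0")
    case True
    then have "{j. improper g j} = {j. improper f j}"
      using fa nfb by (auto simp: imp)
    then show ?thesis by simp
  next
    case False
    \<comment> \<open>The edge above \<open>a\<close> is now indexed by \<open>b\<close>, which was
      not an index before, so the cardinality does not change.\<close>
    then have "{j. improper g j} = insert b ({j. improper f j} - {a})"
      using ba by (auto simp: imp)
    then show ?thesis
      using fa nfb False finite_improper[OF V(1) f] card_Suc_Diff1[of "{j. improper f j}" a] by simp
  qed
  moreover have "proper_children g i = proper_children f i" if i: "i \<in> V - {a} - {b}" for i
  proof (rule Set.set_eqI)
    fix j
    have "i \<noteq> 0" "i \<noteq> a" "i \<noteq> b" using i V(2) by (metis DiffD1, simp_all)
    consider "j = a" | "j = b" | "j \<noteq> a" "j \<noteq> b" "f j = a" | "j \<noteq> a" "j \<noteq> b" "f j \<noteq> a" by blast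
    then show "j \<in> proper_children g i \<longleftrightarrow> j \<in> proper_children f i"
    proof cases
      case 1
      then have "j \<notin> proper_children g i" "j \<notin> proper_children f i"
        using \<open>i \<noteq> 0\<close> fa by (auto simp: proper_children_def contract_simps(1))
      then show ?thesis by simp
    next
      case 2
      then have "j \<notin> proper_children g i" "j \<notin> proper_children f i"
        using \<open>i \<noteq> 0\<close> \<open>i \<noteq> a\<close> ba fb imp[of b] by (auto simp: proper_children_def contract_simps(2))
      then show ?thesis by simp
    next
      case 3
      then show ?thesis
        using \<open>i \<noteq> a\<close> \<open>i \<noteq> b\<close> by (simp add: proper_children_def contract_simps(3))
    next
      case 4
      then show ?thesis
        by (simp add: proper_children_def contract_simps(4) imp)
    qed
  qed
  moreover have "card (proper_children f b) = card (children g b) - card (children f a - {b})"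
  proof -
    have "\<not> improper f j" if j: "f j = b" for j
    proof
      assume "improper f j"
      then obtain l where l: "ancestor f j l" "l < b" "j \<in> V"
        using improper_in[OF f] by (auto simp: improper_def j)
      then have "l = a"
        using bmin[of l] ancestor_mem[OF f l(1,3) V(2)] by auto
      moreover have "ancestor f a j"
        using fb j ancestor_step[OF ancestor_step[OF ancestor_refl], of f j] by simp
      ultimately have "j = a" using l(1) ancestor_antisym[OF acf] by blast
      then show False using j acyclic_fun_grandparent(2)[OF acf b0] fb a by simp
    qed
    then have "proper_children f b = children f b"
      by (auto simp: proper_children_def children_def)
    moreover have "card (children g b) = card (children f a - {b}) + card (children f b)"
      unfolding children_contract[OF acf]
      by (rule card_Un_disjoint)
        (use finite_children[OF V(1) f] a b0 ba in \<open>auto simp: children_def\<close>)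
    ultimately show ?thesis by simp
  qed
  moreover have "(\<Prod>i\<in>V - {a}. h i) = h b * (\<Prod>i\<in>V - {a} - {b}. h i)" for h :: "nat \<Rightarrow> 'a"
    by (rule prod.remove) (use V bV ba in auto)
  ultimately show ?thesis
    by (simp add: weight_def smult_monom)
qed

end

context
  fixes g :: "nat \<Rightarrow> nat" and a b :: nat and V S :: "nat set"
  assumes V: "0 \<notin> V" and aV: "a \<in> V" and bV: "b \<in> V" and ba: "b \<noteq> a"
    and pg: "parent_fun (V - {a}) g" and S: "S \<subseteq> children g b"
begin

lemma expand_nz: "a \<noteq> 0" "b \<noteq> 0" "g a = 0" "g v \<noteq> a" "a \<notin> S" "b \<notin> S" "g b \<noteq> b" "v \<in> S \<Longrightarrow> g v = b"
proof -
  show nz: "a \<noteq> 0" "b \<noteq> 0" using V aV bV by metis+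
  show ga: "g a = 0" using parent_funD(2)[OF pg, of a] by simp
  show "g v \<noteq> a" using parent_funD(3)[OF pg, of v] nz by auto
  show gb: "g b \<noteq> b" using parent_neq[OF parent_funD(1)[OF pg] nz(2)] .
  show "a \<notin> S" "b \<notin> S" using S ga gb nz by (auto simp: children_def)
  show "v \<in> S \<Longrightarrow> g v = b" using S by (auto simp: children_def)
qed

lemma expand_simps:
  "expand a b g S a = g b" "expand a b g S b = a" "v \<in> S \<Longrightarrow> expand a b g S v = a"
  "v \<noteq> a \<Longrightarrow> v \<noteq> b \<Longrightarrow> v \<notin> S \<Longrightarrow> expand a b g S v = g v"
  using ba expand_nz by (auto simp: expand_def)

lemma acyclic_fun_expand: "acyclic_fun (expand a b g S)"
  unfolding acyclic_fun_def
proof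
  let ?f = "expand a b g S"
  note acg = parent_funD(1)[OF pg]
  have "0 \<notin> S" using expand_nz(2) expand_nz(8)[of 0] acyclic_fun_0[OF acg] by auto
  then show "?f 0 = 0" using expand_nz acyclic_fun_0[OF acg] by (simp add: expand_def)
  \<comment> \<open>The induction follows \<open>g\<close>, of which \<open>a\<close> is not a
    vertex; \<open>a\<close> is reached afterwards through its new parent
    \<open>g b\<close>.\<close>
  have *: "v \<noteq> a \<Longrightarrow> ancestor ?f 0 v" for v
    using acg
  proof (induction v rule: acyclic_fun_induct)
    case (1 v)
    have a: "ancestor ?f 0 a" if "ancestor ?f 0 (g b)"
      using that ancestor_step[of ?f 0 a] by (simp add: expand_simps)
    show ?case
    proof (cases "v = 0")
      case v0: False
      have IH: "ancestor ?f 0 (g v)"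
        using 1(1)[OF acyclic_fun_strict_ancestor[OF acg v0]] expand_nz(4) by blast
      consider "v = b" | "v \<in> S" | "v \<noteq> b" "v \<notin> S" by blast
      then show ?thesis
      proof cases
        case 1
        then show ?thesis using IH a ancestor_step[of ?f 0 v] by (simp add: expand_simps)
      next
        case 2
        have "ancestor g (g b) v" "g b \<noteq> v"
          using acyclic_fun_grandparent[OF acg v0] expand_nz(8)[OF 2] expand_nz(2) by auto
        then have "ancestor ?f 0 (g b)" using 1(1) expand_nz(4) by blast
        then show ?thesis using a ancestor_step[of ?f 0 v] 2 by (simp add: expand_simps)
      next
        case 3
        then show ?thesis using IH ancestor_step[of ?f 0 v] 1(2) by (simp add: expand_simps)
      qed
    qed simp
  qed
  show "\<forall>v. ancestor ?f 0 v"
  proof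
    fix v show "ancestor ?f 0 v"
      using *[of v] *[of "g b"] expand_nz(4)[of b] ancestor_step[of ?f 0 a]
      by (cases "v = a") (auto simp: expand_simps)
  qed
qed

lemma parent_fun_expand: "parent_fun V (expand a b g S)"
proof -
  let ?f = "expand a b g S"
  have SV: "S \<subseteq> V"
    using parent_funD(4)[OF pg] expand_nz(2,8) by fastforce
  have "?f v = 0" if "v \<notin> V" for v
    using that aV bV SV parent_funD(2)[OF pg, of v] by (auto simp: expand_def)
  moreover have "?f v \<in> V" if "?f v \<noteq> 0" for v
    using that aV parent_funD(3)[OF pg, of b] parent_funD(3)[OF pg, of v]
    by (auto simp: expand_def split: if_splits)
  moreover have "\<exists>r. {v\<in>V. ?f v = 0} = {r}"
  proof -
    obtain r where r: "{v \<in> V - {a}. g v = 0} = {r}"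
      using pg by (auto simp: parent_fun_def)
    show ?thesis
    proof (cases "g b = 0")
      case True
      then have "b \<in> {r}" unfolding r[symmetric] using bV ba by simp
      have root: "v = b" if "v \<in> V" "v \<noteq> a" "g v = 0" for v
      proof -
        have "v \<in> {r}" unfolding r[symmetric] using that by simp
        then show ?thesis using \<open>b \<in> {r}\<close> by simp
      qed
      have "{v\<in>V. ?f v = 0} = {a}"
        using True aV expand_nz(1) by (auto simp: expand_def dest: root split: if_splits)
      then show ?thesis by blast
    next
      case False
      have "v \<in> V \<and> ?f v = 0 \<longleftrightarrow> v \<in> V - {a} \<and> g v = 0" for v
        using False expand_nz(1,2) expand_nz(8)[of v] expand_simps(1,2) expand_simps(3,4)[of v]
        by (cases "v = a"; cases "v = b"; cases "v \<in> S") simp_all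
      then show ?thesis using r by simp
    qed
  qed
  ultimately show ?thesis
    using acyclic_fun_expand by (auto simp: parent_fun_def)
qed

lemma contract_expand: "contract a b (expand a b g S) = g"
proof
  fix v
  show "contract a b (expand a b g S) v = g v"
    using expand_nz ba by (simp add: contract_def expand_def)
qed

lemma children_expand: "children (expand a b g S) a = insert b S"
  using expand_nz ba by (auto simp: children_def expand_def)

end

section \<open>The child of a vertex on the way to a given descendant\<close>

lemma ancestor_child_exists:
  assumes "acyclic_fun f" "ancestor f u v" "u \<noteq> v" "u \<noteq> 0"
  shows "\<exists>e. f e = u \<and> ancestor f e v"
  using assms
proof (induction v rule: acyclic_fun_induct)
  case (1 v)
  then have v0: "v \<noteq> 0" using ancestor_of_0[of f u] acyclic_fun_0[OF assms(1)] by metis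
  show ?case
  proof (cases "f v = u")
    case False
    have "ancestor f u (f v)" using 1(2,3) ancestor_unfold[of f u v] by simp
    then obtain e where "f e = u" "ancestor f e (f v)"
      using 1(1)[OF acyclic_fun_strict_ancestor[OF assms(1) v0]] False 1(4) by metis
    then show ?thesis using ancestor_step by blast
  qed (use ancestor_refl in blast)
qed

text \<open>Two ancestors of \<open>v\<close> are comparable, but two different children of the same
  vertex are not.\<close>

lemma ancestor_child_unique:
  assumes f: "acyclic_fun f" and "f e = u" "f e' = u" "ancestor f e v" "ancestor f e' v" "u \<noteq> 0"
  shows "e = e'"
proof (rule ccontr)
  assume ne: "e \<noteq> e'"
  have nz: "e \<noteq> 0" "e' \<noteq> 0" using acyclic_fun_0[OF f] assms by metis+
  from ancestor_linear[OF assms(4,5)] show False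
  proof
    assume "ancestor f e e'"
    then have "ancestor f e (f e)" using ne ancestor_unfold[of f e e'] assms by simp
    then show False using not_ancestor_parent[OF f nz(1)] by simp
  next
    assume "ancestor f e' e"
    then have "ancestor f e' (f e')" using ne ancestor_unfold[of f e' e] assms by simp
    then show False using not_ancestor_parent[OF f nz(2)] by simp
  qed
qed

definition toward :: "(nat \<Rightarrow> nat) \<Rightarrow> nat \<Rightarrow> nat \<Rightarrow> nat" where
  "toward f u v = (SOME e. f e = u \<and> ancestor f e v)"

lemma toward:
  assumes "acyclic_fun f" "ancestor f u v" "u \<noteq> v" "u \<noteq> 0"
  shows "f (toward f u v) = u" "ancestor f (toward f u v) v"
  using someI_ex[OF ancestor_child_exists[OF assms]] by (auto simp: toward_def)

lemma toward_eqI: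
  assumes "acyclic_fun f" "f e = u" "ancestor f e v" "u \<noteq> 0"
  shows "toward f u v = e"
  unfolding toward_def
proof (rule some_equality)
  fix e' assume "f e' = u \<and> ancestor f e' v"
  then show "e' = e" using ancestor_child_unique[OF assms(1) _ assms(2) _ assms(3,4)] by blast
qed (use assms in blast)

text \<open>Used contrapositively: if \<open>b\<close> is not below \<open>a\<close>, then
  \<open>a\<close> has a parent, with which it can be swapped.\<close>

lemma root_ancestor:
  assumes f: "parent_fun V f" and "0 \<notin> V" "a \<in> V" "f a = 0"
  shows "v \<in> V \<Longrightarrow> ancestor f a v"
  using parent_funD(1)[OF f]
proof (induction v rule: acyclic_fun_induct)
  case (1 v)
  have v0: "v \<noteq> 0" using 1(2) assms(2) by metis
  show ?case
  proof (cases "f v = 0")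
    case True
    obtain r where "{v\<in>V. f v = 0} = {r}" using f by (auto simp: parent_fun_def)
    moreover have "v \<in> {v\<in>V. f v = 0}" "a \<in> {v\<in>V. f v = 0}" using True 1(2) assms by auto
    ultimately have "v = a" by simp
    then show ?thesis by simp
  next
    case False
    then show ?thesis
      using 1(1)[OF acyclic_fun_strict_ancestor[OF parent_funD(1)[OF f] v0]] parent_funD(3)[OF f] ancestor_step by blast
  qed
qed

section \<open>Weighted sums over trees and their recurrence\<close>

lemma card_children_less:
  assumes "finite V" "parent_fun V f" "i \<in> V" "0 \<notin> V"
  shows "card (children f i) < card V"
proof (rule psubset_card_mono[OF assms(1)])
  have i: "i \<noteq> 0" using assms by metis
  then have "children f i \<subseteq> V" "i \<notin> children f i"
    using parent_funD(4)[OF assms(2)] parent_neq[OF parent_funD(1)[OF assms(2)] i] by (auto simp: children_def)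
  then show "children f i \<subset> V" using assms(3) by blast
qed

text \<open>The label set is arbitrary because contraction deletes the smallest label, and the
  result should again be a sum of the same kind.\<close>

definition tree_sum :: "(nat \<Rightarrow> 'a::comm_ring_1) \<Rightarrow> nat set \<Rightarrow> nat \<Rightarrow> 'a poly" where
  "tree_sum \<phi> V k = (\<Sum>f | parent_fun V f \<and> card (children f (Min V)) = k. weight \<phi> V (Min V) f)"

lemma tree_sum_eq_0:
  assumes "finite V" "V \<noteq> {}" "0 \<notin> V" "card V \<le> k"
  shows "tree_sum \<phi> V k = 0"
proof -
  have "{f. parent_fun V f \<and> card (children f (Min V)) = k} = {}"
    using card_children_less[OF assms(1) _ Min_in[OF assms(1,2)] assms(3)] assms(4) by force
  then show ?thesis unfolding tree_sum_def by (simp only: sum.empty)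
qed

text \<open>Combinatorial reading of the matrix entry: choose the \<open>i\<close> children that
  belong to \<open>a\<close>, then weight \<open>b\<close> by its remaining \<open>j - i\<close>
  children.\<close>

lemma scaled_toeplitz_choose:
  "scaled_toeplitz (\<lambda>m. [:\<phi> m:]) j i = of_nat (j choose i) * [:phi_hat \<phi> (j - i):]"
proof (cases "i \<le> j")
  case True
  then have "fact j div fact i = (j choose i) * fact (j - i)"
    using binomial_fact_lemma[OF True] by (metis fact_nonzero mult.assoc mult.commute nonzero_mult_div_cancel_left)
  then have "scaled_toeplitz (\<lambda>m. [:\<phi> m:]) j i
      = of_nat (j choose i) * (of_nat (fact (j - i)) * [:\<phi> (j - i):])"
    using True unfolding scaled_toeplitz_def toeplitz_matrix_def
    by (simp only: of_nat_mult mult.assoc if_True)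
  also have "of_nat (fact (j - i)) * [:\<phi> (j - i):] = [:phi_hat \<phi> (j - i):]"
    by (simp add: phi_hat_def of_nat_poly)
  finally show ?thesis .
qed (simp add: scaled_toeplitz_eq_0 binomial_eq_0)

context
  fixes V :: "nat set" and a b :: nat
  assumes V: "finite V" "0 \<notin> V" and aV: "a \<in> V" and amin: "\<And>v. v \<in> V \<Longrightarrow> a \<le> v"
    and bV: "b \<in> V" and ba: "b \<noteq> a" and bmin: "\<And>v. v \<in> V \<Longrightarrow> v \<noteq> a \<Longrightarrow> b \<le> v"
begin

lemma vertices_nz: "a \<noteq> 0" "b \<noteq> 0"
  using V aV bV by metis+

text \<open>Contraction is a bijection onto pairs of a smaller tree \<open>g\<close> and an
  \<open>i\<close>-element set of children of \<open>b\<close>. The weight depends on the set only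
  through its size, which gives the binomial coefficient.\<close>

lemma sum_weight_child:
  "(\<Sum>f | parent_fun V f \<and> card (children f a) = Suc i \<and> f b = a. weight \<phi> V a f)
     = (\<Sum>g | parent_fun (V - {a}) g. of_nat (card (children g b) choose i)
          * [:phi_hat \<phi> (card (children g b) - i):] * weight \<phi> (V - {a}) b g)"
proof -
  let ?X = "SIGMA g:{g. parent_fun (V - {a}) g}. {S. S \<subseteq> children g b \<and> card S = i}"
  have fin: "finite {g. parent_fun (V - {a}) g}"
    by (rule finite_parent_fun) (use V in simp)
  have finc: "finite (children g b)" if "parent_fun (V - {a}) g" for g
    by (rule finite_children[OF _ that]) (use V vertices_nz in auto)
  have card: "card (children f a - {b}) = i" if "parent_fun V f" "card (children f a) = Suc i" "f b = a" for f
    using that finite_children[OF V(1) that(1)] vertices_nz by (simp add: children_def)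
  have "(\<Sum>f | parent_fun V f \<and> card (children f a) = Suc i \<and> f b = a. weight \<phi> V a f)
      = (\<Sum>(g, S)\<in>?X. [:phi_hat \<phi> (card (children g b) - i):] * weight \<phi> (V - {a}) b g)"
  proof (rule sum.reindex_bij_witness[where j = "\<lambda>f. (contract a b f, children f a - {b})"
        and i = "\<lambda>(g, S). expand a b g S"], goal_cases)
    case (1 f)
    then show ?case
      using expand_contract[OF vertices_nz ba] parent_funD(1) by auto
  next
    case (2 f)
    then have "parent_fun (V - {a}) (contract a b f)"
      using parent_fun_contract[OF vertices_nz ba _ refl _ V(2)] by auto
    moreover have "children f a - {b} \<subseteq> children (contract a b f) b"
      using children_contract[OF vertices_nz ba _ refl] 2 parent_funD(1) by auto
    ultimately show ?case
      using card 2 by auto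
  next
    case (3 p)
    then obtain g S where p: "p = (g, S)" "parent_fun (V - {a}) g" "S \<subseteq> children g b" "card S = i"
      by auto
    note * = V(2) aV bV ba p(2,3)
    show ?case
      using contract_expand[OF *] children_expand[OF *] expand_nz(6)[OF *] by (simp add: p)
  next
    case (4 p)
    then obtain g S where p: "p = (g, S)" "parent_fun (V - {a}) g" "S \<subseteq> children g b" "card S = i"
      by auto
    note * = V(2) aV bV ba p(2,3)
    have "finite S" using finc[OF p(2)] p(3) by (rule finite_subset[rotated])
    then show ?case
      using parent_fun_expand[OF *] children_expand[OF *] expand_nz(6)[OF *] expand_simps(2)[OF *]
      by (simp add: p)
  next
    case (5 f)
    then show ?case
      using weight_contract[OF vertices_nz ba _ refl _ V amin bmin, of f \<phi>] card[of f] by simp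
  qed
  also have "\<dots> = (\<Sum>g | parent_fun (V - {a}) g. \<Sum>S | S \<subseteq> children g b \<and> card S = i.
      [:phi_hat \<phi> (card (children g b) - i):] * weight \<phi> (V - {a}) b g)"
    by (rule sum.Sigma[symmetric]) (use fin finc in \<open>auto intro: finite_subset[of _ "Pow (children g b)" for g]\<close>)
  also have "\<dots> = (\<Sum>g | parent_fun (V - {a}) g. of_nat (card (children g b) choose i)
          * [:phi_hat \<phi> (card (children g b) - i):] * weight \<phi> (V - {a}) b g)"
    by (rule sum.cong) (simp_all add: n_subsets[OF finc] mult.assoc)
  finally show ?thesis .
qed

text \<open>Which of the two surgeries was applied is read off the result: in the first case \<open>b\<close> is still a
  descendant of \<open>a\<close>, in the second it is not.\<close>

definition demote :: "(nat \<Rightarrow> nat) \<times> nat \<Rightarrow> nat \<Rightarrow> nat" where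
  "demote = (\<lambda>(f, c). if ancestor f a b \<and> \<not> ancestor f c b then f(toward f a b := c) else f(c := f a, a := c))"

definition promote :: "(nat \<Rightarrow> nat) \<Rightarrow> (nat \<Rightarrow> nat) \<times> nat" where
  "promote g = (if ancestor g a b then (g(toward g (toward g a b) b := a), toward g a b)
     else (g(a := g (g a), g a := a), g a))"

text \<open>Let \<open>c\<close> be the marked child of \<open>a\<close>. If \<open>b\<close> lies
  below a different child \<open>e\<close>, then \<open>e\<close> is moved under \<open>c\<close>;
  otherwise \<open>a\<close> and \<open>c\<close> are swapped. In the first case the path from
  \<open>a\<close> to \<open>b\<close> afterwards begins with \<open>a\<close>, \<open>c\<close>,
  \<open>e\<close>, and in the second \<open>a\<close> is no longer above \<open>b\<close>; this is
  how \<open>promote\<close> recovers both the tree and the mark.\<close>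

lemma demote_props:
  assumes f: "parent_fun V f" and fc: "f c = a"
  shows "parent_fun V (demote (f, c))" "card (children (demote (f, c)) a) = card (children f a) - 1"
    "demote (f, c) b \<noteq> a" "promote (demote (f, c)) = (f, c)"
    "weight \<phi> V a (demote (f, c)) = monom 1 1 * weight \<phi> V a f"
proof -
  note acf = parent_funD(1)[OF f]
  have nz: "a \<noteq> 0" "b \<noteq> 0" by (rule vertices_nz)+
  have cV: "c \<in> V" using parent_funD(4)[OF f, of c] fc nz by simp
  have c0: "c \<noteq> 0" using cV V(2) by metis
  have ca: "c \<noteq> a" using parent_neq[OF acf nz(1)] fc by auto
  have fin: "finite (children f a)" by (rule finite_children[OF V(1) f nz(1)])
  have *: "parent_fun V (demote (f, c)) \<and> card (children (demote (f, c)) a) = card (children f a) - 1 \<and>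
    demote (f, c) b \<noteq> a \<and> promote (demote (f, c)) = (f, c) \<and>
    weight \<phi> V a (demote (f, c)) = monom 1 1 * weight \<phi> V a f"
  proof (cases "ancestor f a b \<and> \<not> ancestor f c b")
    case True
    define e where "e = toward f a b"
    have e: "f e = a" "ancestor f e b"
      using toward[OF acf, of a b] True ba nz by (auto simp: e_def)
    have eV: "e \<in> V" using parent_funD(4)[OF f, of e] e nz by simp
    have ce: "c \<noteq> e" using e True by auto
    define g where "g = f(e := c)"
    have g: "demote (f, c) = g" using True by (simp add: demote_def g_def e_def)
    note ins = nz(1) e(1) fc ce g_def
    have acg: "acyclic_fun g" by (rule acyclic_fun_insert_above[OF ins acf])
    have ancestor: "ancestor g i j \<longleftrightarrow> ancestor f i j \<or> (i = c \<and> ancestor f e j)" for i j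
      by (rule ancestor_insert_above[OF ins acf])
    have 1: "parent_fun V g" using f parent_fun_insert_above[OF ins eV cV V(2)] by simp
    have 2: "card (children g a) = card (children f a) - 1"
      unfolding children_insert_above[OF ins acf] using fin e by (simp add: children_def)
    \<comment> \<open>Only one child of \<open>a\<close> leads to \<open>b\<close>, namely
      \<open>e\<close>, and it has just been moved. A child of \<open>a\<close> equal to
      \<open>b\<close> would have to be \<open>e\<close>.\<close>
    have 3: "g b \<noteq> a"
    proof (cases "b = e")
      case False
      then have "f b \<noteq> a" using ancestor_child_unique[OF acf e(1) _ e(2) ancestor_refl nz(1)] by auto
      then show ?thesis using False by (simp add: g_def)
    qed (simp add: g_def ca)
    have "toward g a b = c"
      by (rule toward_eqI[OF acg]) (use ancestor e ce fc nz in \<open>auto simp: g_def\<close>)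
    moreover have "toward g c b = e"
      by (rule toward_eqI[OF acg]) (use ancestor e c0 in \<open>auto simp: g_def\<close>)
    ultimately have 4: "promote g = (f, c)"
      using ancestor True e(1) by (auto simp: promote_def g_def)
    have 5: "weight \<phi> V a g = monom 1 1 * weight \<phi> V a f"
      by (rule weight_insert_above[OF ins f V amin bV ba bmin e(2)]) (use True in auto)
    show ?thesis unfolding g using 1 2 3 4 5 by simp
  next
    case False
    define g where "g = f(c := f a, a := c)"
    have g: "demote (f, c) = g" using False by (auto simp: demote_def g_def)
    note sw = nz(1) fc ca g_def
    have 1: "parent_fun V g" using f parent_fun_swap[OF sw cV aV V(2)] by simp
    have 2: "card (children g a) = card (children f a) - 1"
      unfolding children_swap[OF sw acf] using fin fc by (simp add: children_def)
    have 3: "g b \<noteq> a"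
    proof (cases "b = c")
      case True
      then show ?thesis using parent_neq[OF acf nz(1)] ba by (simp add: g_def)
    next
      case bc: False
      have "f b \<noteq> a"
      proof
        assume fb: "f b = a"
        then have "ancestor f a b" using ancestor_step[OF ancestor_refl, of f b] by simp
        then have "ancestor f c b" using False by simp
        then show False using ancestor_child_unique[OF acf fc fb _ ancestor_refl nz(1)] bc by auto
      qed
      then show ?thesis using bc ba by (simp add: g_def)
    qed
    have "\<not> ancestor g a b" using ancestor_swap[OF sw acf, of a b] False by simp
    then have 4: "promote g = (f, c)"
      using ca fc by (auto simp: promote_def g_def)
    have 5: "weight \<phi> V a g = monom 1 1 * weight \<phi> V a f"
      by (rule weight_swap[OF sw f V aV amin])
    show ?thesis unfolding g using 1 2 3 4 5 by simp
  qed
  then show "parent_fun V (demote (f, c))" "card (children (demote (f, c)) a) = card (children f a) - 1"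
    "demote (f, c) b \<noteq> a" "promote (demote (f, c)) = (f, c)"
    "weight \<phi> V a (demote (f, c)) = monom 1 1 * weight \<phi> V a f" by auto
qed

text \<open>If \<open>b\<close> lies below \<open>a\<close>, then \<open>g b \<noteq> a\<close>
  guarantees at least one intermediate vertex \<open>d\<close>, so there is a next vertex
  \<open>e\<close> to move back up to \<open>a\<close>. If not, \<open>a\<close> is not the root and
  can be swapped with its parent. The mark is \<open>d\<close> or the former parent,
  respectively.\<close>

lemma promote_props:
  assumes g: "parent_fun V g" and gb: "g b \<noteq> a"
  shows "\<exists>f c. promote g = (f, c) \<and> parent_fun V f \<and> f c = a \<and>
    card (children f a) = Suc (card (children g a)) \<and> demote (f, c) = g"
proof (cases "ancestor g a b")
  case True
  note acg = parent_funD(1)[OF g]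
  have nz: "a \<noteq> 0" "b \<noteq> 0" by (rule vertices_nz)+
  define d where "d = toward g a b"
  have d: "g d = a" "ancestor g d b" using toward[OF acg True] ba nz by (auto simp: d_def)
  have dV: "d \<in> V" using parent_funD(4)[OF g, of d] d nz by simp
  have db: "d \<noteq> b" using d(1) gb by auto
  have d0: "d \<noteq> 0" using dV V(2) by metis
  define e where "e = toward g d b"
  have e: "g e = d" "ancestor g e b" using toward[OF acg d(2) db d0] by (auto simp: e_def)
  have eV: "e \<in> V" using parent_funD(4)[OF g, of e] e d0 by simp
  have de: "d \<noteq> e" using e(1) parent_neq[OF acg d0] by auto
  have da: "d \<noteq> a" using d(1) parent_neq[OF acg d0] by auto
  define f where "f = g(e := a)"
  have f: "f e = a" "f d = a" "g = f(e := d)"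
    using d e de by (auto simp: f_def)
  note ins = nz(1) f(1,2) de f(3)
  have pf: "parent_fun V f" using g parent_fun_insert_above[OF ins eV dV V(2)] by simp
  note acf = parent_funD(1)[OF pf]
  have ancestor: "ancestor g i j \<longleftrightarrow> ancestor f i j \<or> (i = d \<and> ancestor f e j)" for i j
    by (rule ancestor_insert_above[OF ins acf])
  have "ancestor f a b" using ancestor[of a b] True da by auto
  moreover have fe: "ancestor f e b" using ancestor[of e b] e(2) de by auto
  moreover have "\<not> ancestor f d b"
    using ancestor_child_unique[OF acf f(1,2) fe _ nz(1)] de by auto
  moreover have "toward f a b = e"
    by (rule toward_eqI[OF acf f(1) fe nz(1)])
  ultimately have "demote (f, d) = g"
    by (simp add: demote_def f(3)[symmetric])
  moreover have "promote g = (f, d)"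
    using True by (simp add: promote_def f_def d_def e_def)
  moreover have "card (children f a) = Suc (card (children g a))"
    unfolding children_insert_above[OF ins acf]
    using finite_children[OF V(1) pf nz(1)] f(1)
    by (subst card_Suc_Diff1) (auto simp: children_def)
  ultimately show ?thesis using pf f(2) by blast
next
  case False
  note acg = parent_funD(1)[OF g]
  have nz: "a \<noteq> 0" "b \<noteq> 0" by (rule vertices_nz)+
  define c where "c = g a"
  have c0: "c \<noteq> 0" using root_ancestor[OF g V(2) aV _ bV] False by (auto simp: c_def)
  have cV: "c \<in> V" using parent_funD(3)[OF g, of a] c0 by (simp add: c_def)
  have ca: "c \<noteq> a" using parent_neq[OF acg nz(1)] by (simp add: c_def)
  define f where "f = g(a := g c, c := a)"
  have f: "f c = a" "g = f(c := f a, a := c)"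
    using ca by (auto simp: f_def c_def)
  note sw = nz(1) f(1) ca f(2)
  have pf: "parent_fun V f" using g parent_fun_swap[OF sw cV aV V(2)] by simp
  note acf = parent_funD(1)[OF pf]
  have "\<not> (ancestor f a b \<and> \<not> ancestor f c b)"
    using ancestor_swap[OF sw acf, of a b] False by simp
  then have "demote (f, c) = g"
    using f(2) by (auto simp: demote_def)
  moreover have "promote g = (f, c)"
    using False by (simp add: promote_def f_def c_def)
  moreover have "card (children f a) = Suc (card (children g a))"
    unfolding children_swap[OF sw acf]
    using finite_children[OF V(1) pf nz(1)] f(1)
    by (subst card_Suc_Diff1) (auto simp: children_def)
  ultimately show ?thesis using pf f(1) by blast
qed

text \<open>Trees in which \<open>b\<close> is not a child of \<open>a\<close> correspond to trees
  with one more child of \<open>a\<close> together with a marked child. Each of the latter trees is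
  therefore counted \<open>Suc k\<close> times, with one factor of \<open>y\<close> for the extra
  improper edge.\<close>

lemma sum_weight_nonchild:
  "(\<Sum>g | parent_fun V g \<and> card (children g a) = k \<and> g b \<noteq> a. weight \<phi> V a g)
     = of_nat (Suc k) * monom 1 1 * (\<Sum>f | parent_fun V f \<and> card (children f a) = Suc k. weight \<phi> V a f)"
proof -
  let ?F = "{f. parent_fun V f \<and> card (children f a) = Suc k}"
  have fin: "finite ?F"
    by (rule finite_subset[OF _ finite_parent_fun[OF V(1)]]) auto
  have "(\<Sum>g | parent_fun V g \<and> card (children g a) = k \<and> g b \<noteq> a. weight \<phi> V a g)
      = (\<Sum>(f, c)\<in>(SIGMA f:?F. children f a). monom 1 1 * weight \<phi> V a f)"
  proof (rule sum.reindex_bij_witness[where i = demote and j = promote], goal_cases)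
    case (1 g)
    then show ?case using promote_props[of g] by auto
  next
    case (2 g)
    then obtain f c where "promote g = (f, c)" "parent_fun V f" "f c = a"
        "card (children f a) = Suc (card (children g a))"
      using promote_props[of g] by auto
    then show ?case using 2 by (simp add: children_def)
  next
    case (3 p)
    then show ?case using demote_props(4) by (cases p) (simp add: children_def)
  next
    case (4 p)
    then show ?case using demote_props(1-3) by (cases p) (simp add: children_def)
  next
    case (5 g)
    then obtain f c where "promote g = (f, c)" "parent_fun V f" "f c = a" "demote (f, c) = g"
      using promote_props[of g] by auto
    then show ?case using demote_props(5)[of f c \<phi>] by simp
  qed
  also have "\<dots> = (\<Sum>f\<in>?F. \<Sum>c\<in>children f a. monom 1 1 * weight \<phi> V a f)"
    by (rule sum.Sigma[symmetric]) (use fin finite_children[OF V(1)] vertices_nz in auto)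
  also have "\<dots> = (\<Sum>f\<in>?F. of_nat (Suc k) * monom 1 1 * weight \<phi> V a f)"
    by (rule sum.cong) (simp_all add: mult.assoc del: of_nat_Suc)
  also have "\<dots> = of_nat (Suc k) * monom 1 1 * (\<Sum>f\<in>?F. weight \<phi> V a f)"
    by (simp only: sum_distrib_left)
  finally show ?thesis .
qed

end

lemma tree_sum_recurrence:
  assumes V: "finite V" "0 \<notin> V" "card V = Suc (Suc n)"
  shows "tree_sum \<phi> V k =
    (case k of 0 \<Rightarrow> 0
     | Suc i \<Rightarrow> \<Sum>j\<le>n. tree_sum \<phi> (V - {Min V}) j * scaled_toeplitz (\<lambda>m. [:\<phi> m:]) j i)
    + of_nat (Suc k) * monom 1 1 * tree_sum \<phi> V (Suc k)"
proof -
  define a where "a = Min V"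
  define b where "b = Min (V - {a})"
  have "V \<noteq> {}" using V by auto
  then have aV: "a \<in> V" and amin: "a \<le> v" if "v \<in> V" for v
    using that V by (auto simp: a_def)
  have card: "card (V - {a}) = Suc n" using aV V by (simp add: \<open>V \<noteq> {}\<close> a_def)
  then have ne: "V - {a} \<noteq> {}" by (metis card.empty nat.distinct(1))
  have b: "b \<in> V - {a}" unfolding b_def by (rule Min_in) (use V ne in auto)
  then have bV: "b \<in> V" and ba: "b \<noteq> a" by auto
  have bmin: "b \<le> v" if "v \<in> V" "v \<noteq> a" for v
    unfolding b_def using V that by (intro Min_le) auto
  have aV: "a \<in> V" unfolding a_def by (rule Min_in) (use V \<open>V \<noteq> {}\<close> in auto)
  note ctx = V(1,2) aV amin bV ba bmin
  have fin: "finite {f. parent_fun V f \<and> Q f}" for Q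
    by (rule finite_subset[OF _ finite_parent_fun[OF V(1)]]) auto
  have "tree_sum \<phi> V k
      = (\<Sum>f | parent_fun V f \<and> card (children f a) = k \<and> f b = a. weight \<phi> V a f)
        + (\<Sum>f | parent_fun V f \<and> card (children f a) = k \<and> f b \<noteq> a. weight \<phi> V a f)"
    unfolding tree_sum_def a_def[symmetric]
    by (subst sum.union_disjoint[symmetric]) (use fin in \<open>auto intro!: sum.cong\<close>)
  also have "(\<Sum>f | parent_fun V f \<and> card (children f a) = k \<and> f b \<noteq> a. weight \<phi> V a f)
      = of_nat (Suc k) * monom 1 1 * tree_sum \<phi> V (Suc k)"
    unfolding tree_sum_def a_def[symmetric] by (rule sum_weight_nonchild[OF ctx])
  also have "(\<Sum>f | parent_fun V f \<and> card (children f a) = k \<and> f b = a. weight \<phi> V a f)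
      = (case k of 0 \<Rightarrow> 0
         | Suc i \<Rightarrow> \<Sum>j\<le>n. tree_sum \<phi> (V - {a}) j * scaled_toeplitz (\<lambda>m. [:\<phi> m:]) j i)"
  proof (cases k)
    case 0
    have "f b \<noteq> a" if "parent_fun V f" "card (children f a) = 0" for f
      using finite_children[OF V(1) that(1), of a] vertices_nz[OF ctx] that(2) by (auto simp: children_def)
    then have "{f. parent_fun V f \<and> card (children f a) = 0 \<and> f b = a} = {}"
      by blast
    then show ?thesis unfolding 0 by (simp only: sum.empty nat.case)
  next
    case (Suc i)
    let ?G = "{g. parent_fun (V - {a}) g}"
    let ?w = "\<lambda>g. scaled_toeplitz (\<lambda>m. [:\<phi> m:]) (card (children g b)) i * weight \<phi> (V - {a}) b g"
    have "finite ?G" by (rule finite_parent_fun) (use V in simp)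
    \<comment> \<open>The contracted trees are grouped by the number of children of their smallest
      vertex \<open>b\<close>; with \<open>n + 1\<close> vertices there are at most \<open>n\<close>
      such children.\<close>
    moreover have "(\<lambda>g. card (children g b)) ` ?G \<subseteq> {..n}"
      using card_children_less[of "V - {a}" _ b] V b card by fastforce
    ultimately have "sum ?w ?G = (\<Sum>j\<le>n. sum ?w {g\<in>?G. card (children g b) = j})"
      by (intro sum.group[symmetric]) auto
    also have "\<dots> = (\<Sum>j\<le>n. tree_sum \<phi> (V - {a}) j * scaled_toeplitz (\<lambda>m. [:\<phi> m:]) j i)"
      unfolding tree_sum_def b_def[symmetric] sum_distrib_right
      by (intro sum.cong) (auto simp: mult.commute)
    finally have "sum ?w ?G = (\<Sum>j\<le>n. tree_sum \<phi> (V - {a}) j * scaled_toeplitz (\<lambda>m. [:\<phi> m:]) j i)" .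
    moreover have "(\<Sum>f | parent_fun V f \<and> card (children f a) = Suc i \<and> f b = a. weight \<phi> V a f) = sum ?w ?G"
      unfolding scaled_toeplitz_choose by (rule sum_weight_child[OF ctx])
    ultimately show ?thesis
      unfolding Suc nat.case by simp
  qed
  finally show ?thesis unfolding a_def .
qed

text \<open>The recurrence and the singleton case determine all values from the cardinality alone,
  so no relabelling of trees is required. Within a fixed cardinality, the induction on
  \<open>k\<close> descends from the range where both sums vanish.\<close>

lemma tree_sum_card_cong:
  assumes "finite V" "0 \<notin> V" "finite V'" "0 \<notin> V'" "card V = Suc n" "card V' = Suc n"
    and base: "\<And>v k. v \<noteq> 0 \<Longrightarrow> tree_sum \<phi> {v} k = (if k = 0 then 1 else 0)"
  shows "tree_sum \<phi> V k = tree_sum \<phi> V' k"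
  using assms(1-6)
proof (induction n arbitrary: V V' k)
  case 0
  then obtain v v' where "V = {v}" "V' = {v'}"
    by (metis One_nat_def card_1_singletonE)
  then show ?case using base 0 by auto
next
  case (Suc n)
  have ne: "V \<noteq> {}" "V' \<noteq> {}" using Suc.prems by auto
  show ?case
  proof (cases "k \<le> Suc (Suc n)")
    case True
    then show ?thesis
    proof (induction rule: inc_induct)
      case base
      then show ?case using Suc.prems ne by (simp add: tree_sum_eq_0)
    next
      case (step k)
      have "tree_sum \<phi> (V - {Min V}) = tree_sum \<phi> (V' - {Min V'})"
        using Suc.prems ne by (intro ext Suc.IH) auto
      then show ?case
        using step tree_sum_recurrence[OF Suc.prems(1,2,5), of \<phi> k]
          tree_sum_recurrence[OF Suc.prems(3,4,6), of \<phi> k] by (cases k) simp_all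
    qed
  next
    case False
    then show ?thesis using Suc.prems ne by (simp add: tree_sum_eq_0)
  qed
qed

lemma tree_sum_singleton:
  assumes "v \<noteq> 0"
  shows "tree_sum \<phi> {v} k = (if k = 0 then 1 else 0)"
proof -
  have "f = (\<lambda>_. 0)" if f: "parent_fun {v} f" for f
  proof
    fix u
    have "f v \<noteq> v" using parent_neq[OF parent_funD(1)[OF f] assms] .
    then show "f u = 0" using parent_funD(3,4)[OF f, of u] by (cases "f u = 0") auto
  qed
  moreover have "parent_fun {v} (\<lambda>_. 0)"
    using ancestor_step[of "\<lambda>_. 0" 0] by (auto simp: parent_fun_def acyclic_fun_def)
  ultimately have "parent_fun {v} f \<longleftrightarrow> f = (\<lambda>_. 0)" for f
    by blast
  moreover have "children (\<lambda>_. 0) v = {}"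
    using assms by (simp add: children_def)
  ultimately have "{f. parent_fun {v} f \<and> card (children f v) = k} = (if k = 0 then {\<lambda>_. 0} else {})"
    by auto
  moreover have "weight \<phi> {v} v (\<lambda>_. 0) = 1"
    by (simp add: weight_def improper_def)
  ultimately show ?thesis
    by (simp add: tree_sum_def)
qed

text \<open>Deleting the minimum of \<open>{1..n + 2}\<close> leaves \<open>{2..n + 2}\<close>,
  whose tree sums agree with those of \<open>{1..n + 1}\<close> by equality of
  cardinalities.\<close>

lemma tree_recurrence_tree_sum:
  "tree_recurrence (\<lambda>m. [:\<phi> m:]) (monom 1 1) (\<lambda>n k. tree_sum \<phi> {1..n + 1} k)"
proof
  show "tree_sum \<phi> {1..0 + 1} k = (if k = 0 then 1 else 0)" for k
    by (simp add: tree_sum_singleton)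
  show "tree_sum \<phi> {1..n + 1} k = 0" if "n < k" for n k
    using that by (intro tree_sum_eq_0) auto
  show "tree_sum \<phi> {1..Suc n + 1} k =
    (case k of 0 \<Rightarrow> 0
     | Suc i \<Rightarrow> \<Sum>j\<le>n. tree_sum \<phi> {1..n + 1} j * scaled_toeplitz (\<lambda>m. [:\<phi> m:]) j i)
    + of_nat (Suc k) * monom 1 1 * tree_sum \<phi> {1..Suc n + 1} (Suc k)" for n k
  proof -
    let ?V = "{1..Suc n + 1}"
    have "tree_sum \<phi> (?V - {Min ?V}) j = tree_sum \<phi> {1..n + 1} j" for j
      by (rule tree_sum_card_cong[of _ _ n]) (auto simp: tree_sum_singleton)
    then show ?thesis
      by (subst tree_sum_recurrence[of ?V n]) (auto split: nat.split)
  qed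
qed

section \<open>Rooted trees as parent functions\<close>

definition graph_of :: "nat set \<Rightarrow> (nat \<Rightarrow> nat) \<Rightarrow> nat rooted_graph" where
  "graph_of V f = Rooted_Graph (THE r. r \<in> V \<and> f r = 0) {{v, f v} | v. f v \<noteq> 0}"

text \<open>Extending a path by a vertex that already occurs in it would break distinctness, so the
  path is cut at that vertex instead.\<close>

lemma rtranclp_imp_is_path:
  assumes "(\<lambda>a b. {a, b} \<in> E)\<^sup>*\<^sup>* u v"
  shows "\<exists>p. is_path E u v p"
  using assms
proof (induction rule: rtranclp_induct)
  case base
  have "is_path E u u [u]" by (simp add: is_path_def)
  then show ?case by blast
next
  case (step v w)
  then obtain p where p: "is_path E u v p" by blast
  show ?case
  proof (cases "w \<in> set p")
    case True
    then obtain xs ys where "p = xs @ w # ys" by (metis split_list)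
    then have *: "p = (xs @ [w]) @ ys" by simp
    then have "successively (\<lambda>a b. {a, b} \<in> E) (xs @ [w])"
      using p successively_append_iff unfolding is_path_def by blast
    then have "is_path E u w (xs @ [w])"
      using p * by (cases xs) (auto simp: is_path_def)
    then show ?thesis by blast
  next
    case False
    then have "is_path E u w (p @ [w])"
      using p step(2) by (auto simp: is_path_def successively_append_iff)
    then show ?thesis by blast
  qed
qed

context
  fixes V :: "nat set" and f :: "nat \<Rightarrow> nat"
  assumes V: "0 \<notin> V" and f: "parent_fun V f"
begin

abbreviation "edges_of \<equiv> rg_edges (graph_of V f)"
abbreviation "root_of \<equiv> rg_root (graph_of V f)"

lemma acf: "acyclic_fun f"
  by (rule parent_funD(1)[OF f])

lemma edge_iff: "{u, v} \<in> edges_of \<longleftrightarrow> (f u = v \<and> v \<noteq> 0) \<or> (f v = u \<and> u \<noteq> 0)"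
  by (auto simp: graph_of_def doubleton_eq_iff)

lemma edge_mem: "{u, v} \<in> edges_of \<Longrightarrow> u \<in> V \<and> v \<in> V"
  unfolding edge_iff using parent_funD(3,4)[OF f] by blast

lemma root: "v \<in> V \<and> f v = 0 \<longleftrightarrow> v = root_of"
proof -
  obtain r' where r': "{v\<in>V. f v = 0} = {r'}" using f unfolding parent_fun_def by blast
  have *: "v \<in> V \<and> f v = 0 \<longleftrightarrow> v = r'" for v
  proof -
    have "v \<in> {v\<in>V. f v = 0} \<longleftrightarrow> v \<in> {r'}" by (simp only: r')
    then show ?thesis by simp
  qed
  then have "root_of = r'" unfolding graph_of_def rooted_graph.sel by (intro the_equality) auto
  with * show ?thesis by simp
qed

text \<open>A path from the root can only descend: its first step cannot go up, and a later upward
  step would return to the preceding vertex, because the parent is unique.\<close>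

lemma root_path_nth:
  assumes p: "is_path edges_of root_of j p"
  shows "Suc i < length p \<Longrightarrow> f (p ! Suc i) = p ! i"
proof (induction i)
  case 0
  have "p ! 0 = root_of" using p hd_conv_nth unfolding is_path_def by metis
  moreover have "{p ! 0, p ! Suc 0} \<in> edges_of"
    using p 0 by (simp add: is_path_def successively_conv_nth)
  ultimately show ?case
    using root[of root_of] unfolding edge_iff by auto
next
  case (Suc i)
  have "{p ! Suc i, p ! Suc (Suc i)} \<in> edges_of"
    using p Suc.prems by (simp add: is_path_def successively_conv_nth)
  moreover have "p ! i \<noteq> p ! Suc (Suc i)"
    using p Suc.prems by (simp add: is_path_def nth_eq_iff_index_eq)
  ultimately show ?case
    using Suc unfolding edge_iff by auto
qed

lemma root_path_ancestor:
  assumes p: "is_path edges_of root_of j p"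
  shows "b < length p \<Longrightarrow> a \<le> b \<Longrightarrow> ancestor f (p ! a) (p ! b)"
proof (induction b)
  case (Suc b)
  show ?case
  proof (cases "a = Suc b")
    case False
    then have "ancestor f (p ! a) (f (p ! Suc b))"
      using Suc root_path_nth[OF p, of b] by simp
    then show ?thesis by (rule ancestor_step)
  qed simp
qed simp

lemma path_mem:
  assumes "is_path edges_of root_of j p" "x \<in> set p"
  shows "x \<in> V"
proof -
  obtain a where a: "a < length p" "x = p ! a" using assms(2) by (metis in_set_conv_nth)
  show ?thesis
  proof (cases a)
    case 0
    then have "x = root_of" using assms(1) a hd_conv_nth unfolding is_path_def by metis
    then show ?thesis using root by blast
  next
    case (Suc a')
    then have "{p ! a', p ! a} \<in> edges_of"
      using assms(1) a by (simp add: is_path_def successively_conv_nth)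
    then show ?thesis using edge_mem a by blast
  qed
qed

lemma root_path_exists: "j \<in> V \<Longrightarrow> \<exists>p. is_path edges_of root_of j p \<and> set p = {i. i \<noteq> 0 \<and> ancestor f i j}"
  using acf
proof (induction j rule: acyclic_fun_induct)
  case (1 j)
  have j0: "j \<noteq> 0" using 1(2) V by metis
  show ?case
  proof (cases "f j = 0")
    case True
    then have "j = root_of" using 1(2) root by blast
    moreover have "{i. i \<noteq> 0 \<and> ancestor f i j} = {j}"
      using j0 True ancestor_unfold[of f _ j] ancestor_of_0[of f] acyclic_fun_0[OF acf] by auto
    ultimately have "is_path edges_of root_of j [j]" "set [j] = {i. i \<noteq> 0 \<and> ancestor f i j}"
      by (simp_all add: is_path_def)
    then show ?thesis by blast
  next
    case False
    then obtain p where p: "is_path edges_of root_of (f j) p" "set p = {i. i \<noteq> 0 \<and> ancestor f i (f j)}"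
      using 1(1)[OF acyclic_fun_strict_ancestor[OF acf j0]] parent_funD(3)[OF f] by blast
    have "j \<notin> set p" using p(2) not_ancestor_parent[OF acf j0] by simp
    moreover have "{f j, j} \<in> edges_of" using False by (simp add: edge_iff)
    ultimately have "is_path edges_of root_of j (p @ [j])"
      using p(1) by (auto simp: is_path_def successively_append_iff)
    moreover have "set (p @ [j]) = {i. i \<noteq> 0 \<and> ancestor f i j}"
      using p(2) j0 ancestor_unfold[of f _ j] by auto
    ultimately show ?thesis by blast
  qed
qed

lemma descendant_graph_of: "descendant (graph_of V f) i j \<longleftrightarrow> j \<in> V \<and> i \<noteq> 0 \<and> ancestor f i j"
proof
  assume "descendant (graph_of V f) i j"
  then obtain p where p: "is_path edges_of root_of j p" "i \<in> set p" by (auto simp: descendant_def)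
  obtain a where a: "a < length p" "i = p ! a" using p(2) by (metis in_set_conv_nth)
  have "p \<noteq> []" "last p = j" using p(1) by (auto simp: is_path_def)
  then have "p ! (length p - 1) = j" "j \<in> set p" by (auto simp: last_conv_nth)
  moreover have "ancestor f (p ! a) (p ! (length p - 1))"
    by (rule root_path_ancestor[OF p(1)]) (use a in auto)
  ultimately show "j \<in> V \<and> i \<noteq> 0 \<and> ancestor f i j"
    using path_mem[OF p(1)] p(2) V a(2) by metis
next
  assume "j \<in> V \<and> i \<noteq> 0 \<and> ancestor f i j"
  then show "descendant (graph_of V f) i j"
    using root_path_exists[of j] by (auto simp: descendant_def)
qed

lemma child_graph_of: "child (graph_of V f) i j \<longleftrightarrow> i \<noteq> 0 \<and> f j = i"
proof
  assume c: "child (graph_of V f) i j"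
  then have *: "(f i = j \<and> j \<noteq> 0) \<or> (f j = i \<and> i \<noteq> 0)" "i \<noteq> 0" "ancestor f i j"
    unfolding child_def descendant_graph_of edge_iff by auto
  then have "f i \<noteq> j" using not_ancestor_parent[OF acf, of i] by auto
  then show "i \<noteq> 0 \<and> f j = i" using * by blast
next
  assume *: "i \<noteq> 0 \<and> f j = i"
  then have "ancestor f i j" using ancestor_step[OF ancestor_refl, of f j] by simp
  then show "child (graph_of V f) i j"
    unfolding child_def descendant_graph_of edge_iff using * parent_funD(4)[OF f, of j] by simp
qed

lemma rtranclp_root: "v \<in> V \<Longrightarrow> (\<lambda>a b. {a, b} \<in> edges_of)\<^sup>*\<^sup>* v root_of"
  using acf
proof (induction v rule: acyclic_fun_induct)
  case (1 v)
  have v0: "v \<noteq> 0" using 1(2) V by metis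
  show ?case
  proof (cases "f v = 0")
    case True
    then have "v = root_of" using 1(2) root by blast
    then show ?thesis by simp
  next
    case False
    then have "(\<lambda>a b. {a, b} \<in> edges_of)\<^sup>*\<^sup>* (f v) root_of"
      using 1(1)[OF acyclic_fun_strict_ancestor[OF acf v0]] parent_funD(3)[OF f] by blast
    moreover have "{v, f v} \<in> edges_of" using False by (simp add: edge_iff)
    ultimately show ?thesis by (rule converse_rtranclp_into_rtranclp[rotated])
  qed
qed

text \<open>At a vertex of maximal depth on a cycle, both neighbours would have to be its parent. On
  a cycle of length at least 3 they are distinct.\<close>

lemma no_cycle_graph_of: "\<not> is_cycle edges_of c"
proof
  assume c: "is_cycle edges_of c"
  let ?n = "length c"
  have n: "3 \<le> ?n" and dist: "distinct c" and "c \<noteq> []" using c by (auto simp: is_cycle_def)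
  define succ where "succ i = (if Suc i < ?n then Suc i else 0)" for i
  define pred where "pred i = (if i = 0 then ?n - 1 else i - 1)" for i
  have adj: "{c ! i, c ! succ i} \<in> edges_of" if "i < ?n" for i
  proof (cases "Suc i < ?n")
    case True
    then show ?thesis using c by (simp add: is_cycle_def successively_conv_nth succ_def)
  next
    case False
    then have "i = ?n - 1" using that by linarith
    then show ?thesis using c False \<open>c \<noteq> []\<close> by (simp add: is_cycle_def succ_def last_conv_nth hd_conv_nth)
  qed
  have "Max ((\<lambda>j. depth f (c ! j)) ` {..<?n}) \<in> (\<lambda>j. depth f (c ! j)) ` {..<?n}"
    using \<open>c \<noteq> []\<close> by (intro Max_in) auto
  then obtain i where i: "i < ?n" "depth f (c ! i) = Max ((\<lambda>j. depth f (c ! j)) ` {..<?n})"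
    by auto
  then have max: "depth f (c ! j) \<le> depth f (c ! i)" if "j < ?n" for j
    using that by simp
  have par: "f (c ! i) = c ! j" if "j < ?n" "{c ! i, c ! j} \<in> edges_of" for j
  proof (rule ccontr)
    assume "f (c ! i) \<noteq> c ! j"
    then have "f (c ! j) = c ! i" "c ! i \<noteq> 0" using that(2) unfolding edge_iff by auto
    moreover from this have "c ! j \<noteq> 0" using acyclic_fun_0[OF acf] by metis
    ultimately show False
      using depth_parent[OF acf, of "c ! j"] max[OF that(1)] by simp
  qed
  have s: "succ i < ?n" "pred i < ?n" "succ (pred i) = i" "succ i \<noteq> pred i"
    using i(1) n by (auto simp: succ_def pred_def)
  have "f (c ! i) = c ! succ i" using par s adj[OF i(1)] by blast
  moreover have "f (c ! i) = c ! pred i"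
    using par[OF s(2)] adj[OF s(2)] s(3) by (simp add: insert_commute)
  ultimately have "c ! succ i = c ! pred i" by simp
  then show False using s dist by (simp add: nth_eq_iff_index_eq)
qed

lemma rooted_tree_on_graph_of: "rooted_tree_on V (graph_of V f)"
  unfolding rooted_tree_on_def
proof (intro conjI ballI)
  show "root_of \<in> V" using root by blast
  show "edges_of \<subseteq> {{u, v} | u v. u \<in> V \<and> v \<in> V \<and> u \<noteq> v}"
  proof
    fix e assume e: "e \<in> edges_of"
    then obtain v where v: "e = {v, f v}" "f v \<noteq> 0" by (auto simp: graph_of_def)
    moreover have "v \<noteq> f v" using v(2) parent_neq[OF acf, of v] acyclic_fun_0[OF acf] by metis
    ultimately show "e \<in> {{u, v} | u v. u \<in> V \<and> v \<in> V \<and> u \<noteq> v}"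
      using edge_mem[of v "f v"] e by blast
  qed
  show "\<nexists>c. is_cycle edges_of c" using no_cycle_graph_of by blast
  fix u v assume uv: "u \<in> V" "v \<in> V"
  have "symp (\<lambda>a b. {a, b} \<in> edges_of)" by (auto simp: symp_def insert_commute)
  then have "(\<lambda>a b. {a, b} \<in> edges_of)\<^sup>*\<^sup>* root_of v"
    using rtranclp_root[OF uv(2)] by (metis sympD symp_rtranclp)
  then have "(\<lambda>a b. {a, b} \<in> edges_of)\<^sup>*\<^sup>* u v"
    using rtranclp_root[OF uv(1)] by (rule rtranclp_trans[rotated])
  then show "\<exists>p. is_path edges_of u v p" by (rule rtranclp_imp_is_path)
qed

lemma improper_edge_graph_of: "improper_edge (graph_of V f) i j \<longleftrightarrow> i = f j \<and> improper f j"
proof -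
  have "f j \<noteq> 0 \<Longrightarrow> ancestor f j l \<Longrightarrow> l \<in> V \<and> j \<noteq> 0" for l
    using ancestor_mem[OF f _ parent_funD(4)[OF f] V] acyclic_fun_0[OF acf] by metis
  then show ?thesis
    unfolding improper_edge_def child_graph_of descendant_graph_of improper_def by auto
qed

lemma imprope_graph_of: "imprope (graph_of V f) = card {j. improper f j}"
proof -
  have "{(i, j). improper_edge (graph_of V f) i j} = (\<lambda>j. (f j, j)) ` {j. improper f j}"
    by (auto simp: improper_edge_graph_of)
  then show ?thesis
    unfolding imprope_def by (simp add: card_image inj_on_def)
qed

lemma pdeg_graph_of: "i \<noteq> 0 \<Longrightarrow> pdeg (graph_of V f) i = card (proper_children f i)"
  unfolding pdeg_def proper_edge_def child_graph_of improper_edge_graph_of proper_children_def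
  by (rule arg_cong[where f = card]) auto

end

lemma graph_of_inj:
  assumes "0 \<notin> V" "parent_fun V f" "parent_fun V g" "graph_of V f = graph_of V g"
  shows "f = g"
proof
  fix j
  show "f j = g j"
    using child_graph_of[OF assms(1,2), of _ j] child_graph_of[OF assms(1,3), of _ j] assms(4) by metis
qed

text \<open>A parent is any neighbour strictly closer to the root. The resulting tree spans
  \<open>V\<close> and uses only edges of \<open>T\<close>; a further edge of \<open>T\<close> would
  close a cycle with a path of this tree.\<close>

lemma graph_of_surj:
  assumes V: "0 \<notin> V" and T: "rooted_tree_on V T"
  shows "\<exists>f. parent_fun V f \<and> graph_of V f = T"
proof -
  define E where "E = rg_edges T"
  define r where "r = rg_root T"
  have r: "r \<in> V" and edges: "E \<subseteq> {{u, v} | u v. u \<in> V \<and> v \<in> V \<and> u \<noteq> v}"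
    and conn: "\<And>u v. u \<in> V \<Longrightarrow> v \<in> V \<Longrightarrow> \<exists>p. is_path E u v p" and acyclic: "\<And>c. \<not> is_cycle E c"
    using T by (auto simp: rooted_tree_on_def E_def r_def)
  have edgeV: "u \<in> V \<and> v \<in> V \<and> u \<noteq> v" if "{u, v} \<in> E" for u v
  proof -
    have "{u, v} \<in> {{u, v} | u v. u \<in> V \<and> v \<in> V \<and> u \<noteq> v}"
      using that edges by (rule rev_subsetD)
    then obtain u' v' where "{u, v} = {u', v'}" "u' \<in> V" "v' \<in> V" "u' \<noteq> v'"
      by (elim CollectE exE conjE)
    then show ?thesis unfolding doubleton_eq_iff by auto
  qed
  define d where "d v = (LEAST n. \<exists>p. is_path E r v p \<and> length p = n)" for v
  \<comment> \<open>The penultimate vertex of a shortest path from the root is closer to it.\<close>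
  have closer: "\<exists>u. {u, v} \<in> E \<and> d u < d v" if v: "v \<in> V" "v \<noteq> r" for v
  proof -
    have "\<exists>p. is_path E r v p \<and> length p = d v"
      unfolding d_def by (rule LeastI_ex) (use conn[OF r v(1)] in blast)
    then obtain p where p: "is_path E r v p" "length p = d v" by blast
    then obtain q where q: "p = q @ [v]"
      unfolding is_path_def by (metis append_butlast_last_id)
    have "q \<noteq> []" using p(1) v(2) by (auto simp: q is_path_def)
    then have "is_path E r (last q) q" "{last q, v} \<in> E"
      using p(1) by (auto simp: q is_path_def successively_append_iff)
    moreover from this have "d (last q) \<le> length q"
      unfolding d_def by (intro Least_le) blast
    ultimately show ?thesis using p(2) q by (intro exI[of _ "last q"]) simp
  qed
  define f where "f v = (if v \<in> V \<and> v \<noteq> r then SOME u. {u, v} \<in> E \<and> d u < d v else 0)" for v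
  have fv: "{f v, v} \<in> E" "d (f v) < d v" if "v \<in> V" "v \<noteq> r" for v
    using someI_ex[OF closer[OF that]] that by (auto simp: f_def)
  have fV: "f v \<in> V \<and> f v \<noteq> 0" if "v \<in> V" "v \<noteq> r" for v
    using edgeV[OF fv(1)[OF that]] V by metis
  have f0: "f v = 0" if "\<not> (v \<in> V \<and> v \<noteq> r)" for v
    using that by (auto simp: f_def)
  have "ancestor f 0 v" for v
  proof (induction v rule: measure_induct_rule[of d])
    case (less v)
    then show ?case
      using fv(2)[of v] f0[of v] ancestor_step[of f 0 v] by (cases "v \<in> V \<and> v \<noteq> r") auto
  qed
  moreover have "f 0 = 0" using V by (intro f0) auto
  moreover have "{v\<in>V. f v = 0} = {r}"
  proof -
    have "v \<in> V \<and> f v = 0 \<longleftrightarrow> v = r" for v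
      using fV[of v] f0[of v] r by (cases "v \<in> V \<and> v \<noteq> r") auto
    then show ?thesis by simp
  qed
  moreover have "f v \<in> V" if "f v \<noteq> 0" for v
    using that fV[of v] f0[of v] by (cases "v \<in> V \<and> v \<noteq> r") auto
  ultimately have pf: "parent_fun V f"
    using f0 by (auto simp: parent_fun_def acyclic_fun_def)
  have rg: "rg_root (graph_of V f) = r"
    using root[OF V pf, of r] r f0[of r] by simp
  have sub: "rg_edges (graph_of V f) \<subseteq> E"
  proof
    fix e assume "e \<in> rg_edges (graph_of V f)"
    then obtain v where v: "e = {v, f v}" "f v \<noteq> 0" by (auto simp: graph_of_def)
    have "v \<in> V \<and> v \<noteq> r"
      by (rule ccontr) (use f0[of v] v(2) in simp)
    then show "e \<in> E" using fv(1)[of v] v(1) by (simp add: insert_commute)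
  qed
  have "E \<subseteq> rg_edges (graph_of V f)"
  proof
    fix e assume e: "e \<in> E"
    then obtain u v where uv: "e = {u, v}" using edges by blast
    then have uvV: "u \<in> V" "v \<in> V" "u \<noteq> v" using edgeV e by auto
    obtain p where p: "is_path (rg_edges (graph_of V f)) u v p"
      using rooted_tree_on_graph_of[OF V pf] uvV unfolding rooted_tree_on_def by blast
    show "e \<in> rg_edges (graph_of V f)"
    proof (rule ccontr)
      assume not: "e \<notin> rg_edges (graph_of V f)"
      \<comment> \<open>A one-vertex path would force \<open>u = v\<close>, and a two-vertex path
        would be the missing edge itself.\<close>
      have "length p \<noteq> 0" "length p \<noteq> 1" "length p \<noteq> 2"
        using p uvV(3) not by (auto simp: is_path_def uv length_Suc_conv numeral_2_eq_2)
      then have "3 \<le> length p" by linarith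
      moreover have "successively (\<lambda>a b. {a, b} \<in> E) p"
        by (rule successively_mono[of "\<lambda>a b. {a, b} \<in> rg_edges (graph_of V f)"])
          (use p sub in \<open>auto simp: is_path_def\<close>)
      ultimately have "is_cycle E p"
        using p e by (auto simp: is_cycle_def is_path_def uv insert_commute)
      then show False using acyclic by blast
    qed
  qed
  with sub rg have "graph_of V f = T"
    by (intro rooted_graph.expand) (auto simp: E_def r_def)
  with pf show ?thesis by blast
qed

section \<open>Total positivity\<close>

lemma t_poly_eq_tree_sum: "t_poly \<phi> n k = tree_sum \<phi> {1..n + 1} k"
proof -
  let ?V = "{1..n + 1}"
  have V: "0 \<notin> ?V" and Min: "Min ?V = 1" and diff: "?V - {1} = {2..n + 1}"
    by (auto intro!: Min_eqI)
  let ?F = "{f. parent_fun ?V f \<and> card (children f 1) = k}"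
  have children: "{j. child (graph_of ?V f) 1 j} = children f 1" if "parent_fun ?V f" for f
    unfolding child_graph_of[OF V that] children_def by simp
  have "graph_of ?V ` ?F = trees_1 n k"
  proof
    show "graph_of ?V ` ?F \<subseteq> trees_1 n k"
      using children rooted_tree_on_graph_of[OF V] by (auto simp: trees_1_def)
    show "trees_1 n k \<subseteq> graph_of ?V ` ?F"
    proof
      fix T assume T: "T \<in> trees_1 n k"
      then obtain f where "parent_fun ?V f" "graph_of ?V f = T"
        using graph_of_surj[OF V, of T] by (auto simp: trees_1_def)
      then show "T \<in> graph_of ?V ` ?F"
        using T children[of f] by (auto simp: trees_1_def)
    qed
  qed
  moreover have "inj_on (graph_of ?V) ?F"
    using graph_of_inj[OF V] by (auto simp: inj_on_def)
  ultimately have "bij_betw (graph_of ?V) ?F (trees_1 n k)"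
    by (simp only: bij_betw_def)
  then have "t_poly \<phi> n k
      = (\<Sum>f\<in>?F. monom (\<Prod>i=2..n + 1. phi_hat \<phi> (pdeg (graph_of ?V f) i)) (imprope (graph_of ?V f)))"
    unfolding t_poly_def by (rule sum.reindex_bij_betw[symmetric])
  also have "\<dots> = (\<Sum>f\<in>?F. weight \<phi> ?V 1 f)"
  proof (rule sum.cong[OF refl])
    fix f assume "f \<in> ?F"
    then have f: "parent_fun ?V f" by simp
    have "(\<Prod>i=2..n + 1. phi_hat \<phi> (pdeg (graph_of ?V f) i))
        = (\<Prod>i=2..n + 1. phi_hat \<phi> (card (proper_children f i)))"
      by (rule prod.cong) (use pdeg_graph_of[OF V f] in auto)
    then show "monom (\<Prod>i=2..n + 1. phi_hat \<phi> (pdeg (graph_of ?V f) i)) (imprope (graph_of ?V f))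
        = weight \<phi> ?V 1 f"
      unfolding weight_def imprope_graph_of[OF V f] diff by simp
  qed
  also have "\<dots> = tree_sum \<phi> ?V k"
    unfolding tree_sum_def Min ..
  finally show ?thesis .
qed

text \<open>For the Hankel statement, \<open>x\<close> has to be an element of the ring in which the
  recurrence holds, so the recurrence is carried from \<open>R[y]\<close> to
  \<open>R[y][x]\<close>.\<close>

lemma tree_recurrence_const_poly:
  assumes "tree_recurrence \<phi> y t"
  shows "tree_recurrence (\<lambda>m. [:\<phi> m:]) [:y:] (\<lambda>n k. [:t n k:])"
proof -
  interpret tree_recurrence \<phi> y t by fact
  interpret c: comm_ring_hom "\<lambda>c :: 'a. [:c:]"
    by unfold_locales (auto simp: one_pCons)
  have s: "scaled_toeplitz (\<lambda>m. [:\<phi> m:]) j i = [:scaled_toeplitz \<phi> j i:]" for i j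
    unfolding scaled_toeplitz_def toeplitz_matrix_def by (cases "i \<le> j") (simp_all add: of_nat_poly)
  show ?thesis
  proof
    show "[:t 0 k:] = (if k = 0 then 1 else 0)" for k
      by (simp add: t_0)
    show "[:t n k:] = 0" if "n < k" for n k
      using that by (simp add: t_eq_0)
    show "[:t (Suc n) k:] = (case k of 0 \<Rightarrow> 0
        | Suc i \<Rightarrow> \<Sum>j\<le>n. [:t n j:] * scaled_toeplitz (\<lambda>m. [:\<phi> m:]) j i)
      + of_nat (Suc k) * [:y:] * [:t (Suc n) (Suc k):]" for n k
    proof -
      have "[:t (Suc n) k:] = [:case k of 0 \<Rightarrow> 0 | Suc i \<Rightarrow> \<Sum>j\<le>n. t n j * scaled_toeplitz \<phi> j i:]
          + [:of_nat (Suc k):] * [:y:] * [:t (Suc n) (Suc k):]"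
        by (subst t_Suc) simp
      also have "[:of_nat (Suc k):] = of_nat (Suc k)"
        by (rule of_nat_poly[symmetric])
      also have "[:case k of 0 \<Rightarrow> 0 | Suc i \<Rightarrow> \<Sum>j\<le>n. t n j * scaled_toeplitz \<phi> j i:]
          = (case k of 0 \<Rightarrow> 0 | Suc i \<Rightarrow> \<Sum>j\<le>n. [:t n j:] * scaled_toeplitz (\<lambda>m. [:\<phi> m:]) j i)"
      proof (cases k)
        case (Suc i)
        then show ?thesis by (simp add: s c.hom_sum mult.commute)
      qed simp
      finally show ?thesis .
    qed
  qed
qed

theorem theorem1p8:
  fixes r :: enat
    and P :: "'a::comm_ring_1 set"
    and \<phi> :: "nat \<Rightarrow> 'a"
  assumes "1 \<le> r"
    and "partially_ordered_ring P"
    and "toeplitz_totally_positive P r \<phi>"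
  shows "totally_positive (coeffwise P) r (t_poly \<phi>) \<and>
    hankel_totally_positive (coeffwise (coeffwise P)) r (T_poly \<phi>)"
proof
  let ?Q = "coeffwise P"
  have Q: "partially_ordered_ring ?Q"
    by (rule partially_ordered_ring_coeffwise[OF assms(2)])
  have QQ: "partially_ordered_ring (coeffwise ?Q)"
    by (rule partially_ordered_ring_coeffwise[OF Q])
  \<comment> \<open>The same term at two types: the indeterminate \<open>y\<close> of
    \<open>R[y]\<close>, and the indeterminate \<open>x\<close> over \<open>R[y]\<close>.\<close>
  have y: "monom 1 1 \<in> ?Q" and x: "monom 1 1 \<in> coeffwise ?Q"
    using monom_in_coeffwise por_basic(2) assms(2) Q by blast+
  have "[:monom 1 1:] = monom (monom 1 1 :: 'a poly) 0"
    by (simp add: monom_0)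
  then have y': "[:monom 1 1:] \<in> coeffwise ?Q"
    using monom_in_coeffwise[OF Q y, of 0] by simp
  have \<phi>: "toeplitz_totally_positive ?Q r (\<lambda>m. [:\<phi> m:])"
    by (rule toeplitz_totally_positive_const_poly[OF assms(2,3)])
  have rec: "tree_recurrence (\<lambda>m. [:\<phi> m:]) (monom 1 1) (t_poly \<phi>)"
    using tree_recurrence_tree_sum[of \<phi>] by (simp add: t_poly_eq_tree_sum[abs_def])
  show "totally_positive ?Q r (t_poly \<phi>)"
    by (rule tree_recurrence.totally_positive_t[OF rec Q y \<phi>])
  have "T_poly \<phi> = (\<lambda>n. \<Sum>j\<le>n. [:t_poly \<phi> n j:] * monom 1 1 ^ j)"
    by (simp add: T_poly_def monom_power smult_monom fun_eq_iff)
  then show "hankel_totally_positive (coeffwise ?Q) r (T_poly \<phi>)"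
    using tree_recurrence.hankel_totally_positive_row_polynomials[OF
        tree_recurrence_const_poly[OF rec] QQ y' toeplitz_totally_positive_const_poly[OF Q \<phi>] x]
    by simp
qed

end
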